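(* Let $R\ge R_0=\|x^0-x^*\|$, $Q=B_{2R}(x^* )$, and assume that $\mathbb{E}\|F_\xi(x)-F(x)\|^2\le\sigma^2$ for all $x\in Q$, $\langle F(x)-F(y),x-y\rangle\ge0$ for all $x,y\in Q$, and, for some $\ell>0$, $\|F(x)\|^2\le\ell\langle F(x),x-\mathrm{proj}(x)\rangle$ for all $x\in Q$, where $\mathrm{proj}(x)$ is the projection of $x$ onto the solution set $\mathcal X^*$. Let $K\ge0$ and $\beta\in(0,1]$ be such that $\ln\frac{6(K+1)}\beta\ge1$. Consider clipped-SGDA with $m_k\equiv m$ and $\lambda_k\equiv\lambda=\frac R{60\gamma\ln\frac{6(K+1)}\beta}$, and let $x^K_{\rm avg}=\frac1{K+1}\sum_{k=0}^Kx^k$. Call (a) the condition $\gamma\le\frac1{170\ell\ln\frac{6(K+1)}\beta}$ and (b) the condition $m\ge\max\left\{1,\frac{97200(K+1)\gamma^2\sigma^2\ln\frac{6(K+1)}\beta}{R^2}\right\}$. Then the following statements hold. 1. (Large stepsize/large batch.) The choice $$\gamma=\frac1{170\ell\ln\frac{6(K+1)}\beta},\qquad m=\max\left\{1,\frac{972(K+1)\sigma^2}{289\ell^2R^2\ln\frac{6(K+1)}\beta}\right\}$$ satisfies (a) and (b). With this choice, the iterates produced by clipped-SGDA after $K$ iterations with probability at least $1-\beta$ satisfy $$\mathrm{Gap}_R(x^K_{\rm avg})\le\frac{765\ell R^2\ln\frac{6(K+1)}\beta}{K+1}.$$ In particular, to guarantee $\mathrm{Gap}_R(x^K_{\rm avg})\le\varepsilon$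 with probability at least $1-\beta$ for some $\varepsilon>0$, clipped-SGDA requires $O\left(\frac{\ell R^2}\varepsilon\ln\left(\frac{\ell R^2}{\varepsilon\beta}\right)\right)$ iterations and $O\left(\max\left\{\frac{\ell R^2}\varepsilon,\frac{\sigma^2R^2}{\varepsilon^2}\right\}\ln\left(\frac{\ell R^2}{\varepsilon\beta}\right)\right)$ oracle calls. 2. (Small stepsize/small batch.) The choice $$\gamma=\min\left\{\frac1{170\ell\ln\frac{6(K+1)}\beta},\frac R{180\sigma\sqrt{3(K+1)\ln\frac{6(K+1)}\beta}}\right\},\qquad m=1$$ satisfies (a) and (b). With this choice, the iterates produced by clipped-SGDA after $K$ iterations with probability at least $1-\beta$ satisfy $$\mathrm{Gap}_R(x^K_{\rm avg})\le\max\left\{\frac{765\ell R^2\ln\frac{6(K+1)}\beta}{K+1},\frac{810\sigma R\sqrt{3\ln\frac{6(K+1)}\beta}}{\sqrt{K+1}}\right\}.$$ In particular, to guarantee $\mathrm{Gap}_R(x^K_{\rm avg})\le\varepsilon$ with probability at least $1-\beta$ for some $\varepsilon>0$, clipped-SGDA requires $O\left(\max\left\{\frac{\ell R^2}\varepsilon\ln\left(\frac{\ell R^2}{\varepsilon\beta}\right),\frac{\sigma^2R^2}{\varepsilon^2}\ln\left(\frac{\sigma^2R^2}{\varepsilon^2\beta}\right)\right\}\right)$ iterations/oracle calls.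
   Context: Notation: $\|\cdot\|$ is the Euclidean norm, $B_r(x)=\{u\in\mathbb{R}^d:\|u-x\|\le r\}$. $F:\mathbb{R}^d\to\mathbb{R}^d$ with $F(x)=\mathbb{E}_{\xi\sim\mathcal D}[F_\xi(x)]$, where $F_\xi(x)$ is a stochastic oracle. $\mathcal X^*=\{x\in\mathbb{R}^d:F(x)=0\}$ is the solution set, $x^0$ is the starting point, $x^*$ is the projection of $x^0$ onto $\mathcal X^*$. $\mathrm{Gap}_R(x)=\max_{y\in B_R(x^* )}\langle F(y),x-y\rangle$. $\mathrm{clip}(y,\lambda)=\min\{1,\lambda/\|y\|\}y$ for $y\ne0$, $\mathrm{clip}(0,\lambda)=0$, for $\lambda>0$. clipped-SGDA, for $k=0,1,\dots$: $x^{k+1}=x^k-\gamma\widetilde F_{\boldsymbol\xi^k}(x^k)$, $\widetilde F_{\boldsymbol\xi^k}(x^k)=\mathrm{clip}\left(\frac1{m_k}\sum_{i=1}^{m_k}F_{\xi^{i,k}}(x^k),\lambda_k\right)$, where all $\xi^{i,k}$ are independent samples from $\mathcal D$; $\gamma>0$ is the stepsize, $\lambda_k>0$ are clipping levels, $m_k$ are batchsizes. An oracle call is one evaluation of some $F_\xi(x)$; the total number of oracle calls is $m(K+1)$. $O(\cdot)$ hides numerical constants.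
   Formalization: The O-bounds are claimed only for ε with ℓR²/ε ≥ 1 and ln(ℓR²/(εβ)) ≥ 1 (item 2: the larger of the two ratios and of the two logarithms at least 1), since otherwise the expressions in O can be zero or negative; fractional batch sizes are rounded up. *)

theory Defs
  imports "HOL-Probability.Probability"
begin

definition clip :: "real ^ 'd \<Rightarrow> real \<Rightarrow> real ^ 'd" where
  "clip y lam = (if y = 0 then 0 else min 1 (lam / norm y) *\<^sub>R y)"

definition mean_operator :: "'s measure \<Rightarrow> ('s \<Rightarrow> real ^ 'd \<Rightarrow> real ^ 'd) \<Rightarrow> real ^ 'd \<Rightarrow> real ^ 'd" where
  "mean_operator D G x = (\<integral>s. G s x \<partial>D)"

definition solution_set :: "(real ^ 'd \<Rightarrow> real ^ 'd) \<Rightarrow> (real ^ 'd) set" where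
  "solution_set F = {x. F x = 0}"

(* A relation rather than the function closest_point, whose value is arbitrary where no nearest
   point exists: stating that a projection exists at the points where it is used then requires
   neither closedness nor convexity of S. *)
definition is_projection :: "(real ^ 'd) set \<Rightarrow> real ^ 'd \<Rightarrow> real ^ 'd \<Rightarrow> bool" where
  "is_projection S x p \<longleftrightarrow> p \<in> S \<and> (\<forall>z\<in>S. norm (x - p) \<le> norm (x - z))"

(* The maximum over the ball need not be attained, since F is not assumed continuous, so it is
   read as a supremum. It is finite whenever F is bounded on the ball, which star-cocoercivity on
   a larger ball ensures: norm (F y) \<le> l * norm (y - proj y) \<le> l * norm (y - xstar). *)
definition gap :: "(real ^ 'd \<Rightarrow> real ^ 'd) \<Rightarrow> real ^ 'd \<Rightarrow> real \<Rightarrow> real ^ 'd \<Rightarrow> real" where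
  "gap F xstar R x = (SUP y\<in>cball xstar R. F y \<bullet> (x - y))"

(* s i k is the i-th sample (counted from 1) drawn in step k. *)
primrec clipped_SGDA ::
  "('s \<Rightarrow> real ^ 'd \<Rightarrow> real ^ 'd) \<Rightarrow> real \<Rightarrow> (nat \<Rightarrow> real) \<Rightarrow> (nat \<Rightarrow> nat) \<Rightarrow> real ^ 'd
    \<Rightarrow> (nat \<Rightarrow> nat \<Rightarrow> 's) \<Rightarrow> nat \<Rightarrow> real ^ 'd" where
  "clipped_SGDA G \<gamma> lam m x0 s 0 = x0"
| "clipped_SGDA G \<gamma> lam m x0 s (Suc k) =
     (let x = clipped_SGDA G \<gamma> lam m x0 s k
      in x - \<gamma> *\<^sub>R clip ((1 / real (m k)) *\<^sub>R (\<Sum>i=1..m k. G (s i k) x)) (lam k))"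

definition average_iterate :: "(nat \<Rightarrow> real ^ 'd) \<Rightarrow> nat \<Rightarrow> real ^ 'd" where
  "average_iterate x K = (1 / real (K + 1)) *\<^sub>R (\<Sum>k=0..K. x k)"

(* D is the sample distribution, G the oracle, and \<xi> i k are the samples, defined on M.
   Joint measurability of the oracle makes the iterates random vectors. Integrability is required
   explicitly because the Bochner integral of a non-integrable function is 0. *)
definition sampled_oracle ::
  "'w measure \<Rightarrow> 's measure \<Rightarrow> ('s \<Rightarrow> real ^ 'd \<Rightarrow> real ^ 'd) \<Rightarrow> (nat \<Rightarrow> nat \<Rightarrow> 'w \<Rightarrow> 's) \<Rightarrow> bool" where
  "sampled_oracle M D G \<xi> \<longleftrightarrow>
     prob_space M \<and> prob_space D \<and>
     (\<lambda>(s, x). G s x) \<in> borel_measurable (D \<Otimes>\<^sub>M borel) \<and>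
     (\<forall>x. integrable D (\<lambda>s. G s x)) \<and>
     prob_space.indep_vars M (\<lambda>_. D) (\<lambda>(i, k). \<xi> i k) UNIV \<and>
     (\<forall>i k. distr M D (\<xi> i k) = D)"

definition bounded_variance_on ::
  "(real ^ 'd) set \<Rightarrow> 's measure \<Rightarrow> ('s \<Rightarrow> real ^ 'd \<Rightarrow> real ^ 'd) \<Rightarrow> real \<Rightarrow> bool" where
  "bounded_variance_on Q D G \<sigma> \<longleftrightarrow>
     (\<forall>x\<in>Q. integrable D (\<lambda>s. (norm (G s x - mean_operator D G x))\<^sup>2) \<and>
            (\<integral>s. (norm (G s x - mean_operator D G x))\<^sup>2 \<partial>D) \<le> \<sigma>\<^sup>2)"

definition monotone_operator_on :: "(real ^ 'd) set \<Rightarrow> (real ^ 'd \<Rightarrow> real ^ 'd) \<Rightarrow> bool" where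
  "monotone_operator_on Q F \<longleftrightarrow> (\<forall>x\<in>Q. \<forall>y\<in>Q. (F x - F y) \<bullet> (x - y) \<ge> 0)"

definition star_cocoercive_on ::
  "(real ^ 'd) set \<Rightarrow> (real ^ 'd \<Rightarrow> real ^ 'd) \<Rightarrow> (real ^ 'd \<Rightarrow> real ^ 'd) \<Rightarrow> real \<Rightarrow> bool" where
  "star_cocoercive_on Q F proj l \<longleftrightarrow>
     (\<forall>x\<in>Q. is_projection (solution_set F) x (proj x) \<and>
            (norm (F x))\<^sup>2 \<le> l * (F x \<bullet> (x - proj x)))"

definition SGDA_problem ::
  "real \<Rightarrow> real \<Rightarrow> real \<Rightarrow> 'w measure \<Rightarrow> 's measure \<Rightarrow> ('s \<Rightarrow> real ^ 'd \<Rightarrow> real ^ 'd)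
    \<Rightarrow> (nat \<Rightarrow> nat \<Rightarrow> 'w \<Rightarrow> 's) \<Rightarrow> real ^ 'd \<Rightarrow> real ^ 'd \<Rightarrow> (real ^ 'd \<Rightarrow> real ^ 'd) \<Rightarrow> bool" where
  "SGDA_problem l R \<sigma> M D G \<xi> x0 xstar proj \<longleftrightarrow>
     (let F = mean_operator D G; Q = cball xstar (2 * R) in
       sampled_oracle M D G \<xi> \<and>
       is_projection (solution_set F) x0 xstar \<and>
       norm (x0 - xstar) \<le> R \<and>
       bounded_variance_on Q D G \<sigma> \<and>
       monotone_operator_on Q F \<and>
       star_cocoercive_on Q F proj l)"

definition log_factor :: "real \<Rightarrow> nat \<Rightarrow> real" where
  "log_factor \<beta> K = ln (6 * (real K + 1) / \<beta>)"

definition clip_level :: "real \<Rightarrow> real \<Rightarrow> real \<Rightarrow> nat \<Rightarrow> real" where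
  "clip_level R \<gamma> \<beta> K = R / (60 * \<gamma> * log_factor \<beta> K)"

definition gap_prob ::
  "'w measure \<Rightarrow> 's measure \<Rightarrow> ('s \<Rightarrow> real ^ 'd \<Rightarrow> real ^ 'd) \<Rightarrow> (nat \<Rightarrow> nat \<Rightarrow> 'w \<Rightarrow> 's)
    \<Rightarrow> real ^ 'd \<Rightarrow> real ^ 'd \<Rightarrow> real \<Rightarrow> real \<Rightarrow> real \<Rightarrow> nat \<Rightarrow> nat \<Rightarrow> real \<Rightarrow> real" where
  "gap_prob M D G \<xi> x0 xstar R \<beta> \<gamma> m K c =
     measure M {\<omega> \<in> space M.
       gap (mean_operator D G) xstar R
         (average_iterate
            (clipped_SGDA G \<gamma> (\<lambda>_. clip_level R \<gamma> \<beta> K) (\<lambda>_. m) x0 (\<lambda>i k. \<xi> i k \<omega>)) K) \<le> c}"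

definition stepsize_cond :: "real \<Rightarrow> real \<Rightarrow> nat \<Rightarrow> real \<Rightarrow> bool" where
  "stepsize_cond l \<beta> K \<gamma> \<longleftrightarrow> \<gamma> \<le> 1 / (170 * l * log_factor \<beta> K)"

definition batchsize_cond :: "real \<Rightarrow> real \<Rightarrow> real \<Rightarrow> nat \<Rightarrow> real \<Rightarrow> real \<Rightarrow> bool" where
  "batchsize_cond R \<sigma> \<beta> K \<gamma> m \<longleftrightarrow>
     m \<ge> max 1 (97200 * (real K + 1) * \<gamma>\<^sup>2 * \<sigma>\<^sup>2 * log_factor \<beta> K / R\<^sup>2)"

definition stepsize_large :: "real \<Rightarrow> real \<Rightarrow> nat \<Rightarrow> real" where
  "stepsize_large l \<beta> K = 1 / (170 * l * log_factor \<beta> K)"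

(* Real-valued as in the formula; the algorithm is run with its ceiling. *)
definition batchsize_large :: "real \<Rightarrow> real \<Rightarrow> real \<Rightarrow> real \<Rightarrow> nat \<Rightarrow> real" where
  "batchsize_large l R \<sigma> \<beta> K =
     max 1 (972 * (real K + 1) * \<sigma>\<^sup>2 / (289 * l\<^sup>2 * R\<^sup>2 * log_factor \<beta> K))"

(* For \<sigma> = 0 the second argument of the minimum is R / 0 = \<infinity> in the mathematics, but 0 in HOL. *)
definition stepsize_small :: "real \<Rightarrow> real \<Rightarrow> real \<Rightarrow> real \<Rightarrow> nat \<Rightarrow> real" where
  "stepsize_small l R \<sigma> \<beta> K =
     (if \<sigma> = 0 then 1 / (170 * l * log_factor \<beta> K)
      else min (1 / (170 * l * log_factor \<beta> K))
               (R / (180 * \<sigma> * sqrt (3 * (real K + 1) * log_factor \<beta> K))))"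

(* The constant hidden in the O-bounds, deliberately generous. It is a numeral because an
   existentially quantified one inside a theorem could depend on the type variables of that
   theorem, hence on the dimension. The bounds are claimed for \<epsilon> small enough that the leading
   ratio and the logarithm are at least 1; otherwise the expressions inside O may vanish or be
   negative, although the counts are at least 1. (Gap at most 2 * l * R\<^sup>2 already holds at x0.) *)
definition O_const :: real where
  "O_const = 10 ^ 10"

end

theory Submission
  imports Defs
begin

text \<open>The noise of step \<open>k\<close> is \<open>e k = \<gamma> *\<^sub>R (F (x k) - clip (mean of the batch) lam)\<close>, with partial sums \<open>W k\<close>.
  Expanding squares, and using monotonicity against \<open>u\<close> and star-cocoercivity against the projection
  \<open>p (x k)\<close>, the quantity
  \<open>(norm (x k - u))\<^sup>2 - 2 * ((xstar - u) \<bullet> W k) + (norm (W k))\<^sup>2 + (infdist (x k) S)\<^sup>2\<close> plus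
  \<open>2 * \<gamma> * (\<Sum>j<k. F (x j) \<bullet> (x j - u))\<close> grows in each step at most by a scalar
  \<open>2 * (a \<bullet> e k) + 3 * (norm (e k))\<^sup>2\<close> that does not depend on \<open>u\<close>, where \<open>a\<close> is determined by the past.
  The distance to the solution set \<open>S\<close> absorbs the terms \<open>\<gamma>\<^sup>2 * (norm (F x))\<^sup>2\<close>, since the coercivity
  assumption refers to the projection of the current point and not to \<open>xstar\<close>.
  Clipping is the projection onto a ball containing \<open>F x\<close>, so it does not increase the variance and its
  bias is quadratic in the deviation. Hence the sum \<open>Z\<close> of these scalars has an exponential
  moment \<open>\<le> exp (A / 2)\<close>, and \<open>Z \<le> R\<^sup>2\<close> with probability at least \<open>1 - exp (- A)\<close>. On this one event the
  iterates stay in the ball of radius \<open>2 * R\<close> and the gap is at most \<open>9 * R\<^sup>2 / (2 * \<gamma> * (K + 1))\<close>.\<close>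

text \<open>For negative \<open>y\<close> put \<open>x = - y\<close>. The Taylor lower bound
  \<open>1 + x + x\<^sup>2 / 2\<close> of \<open>exp x\<close>, multiplied by
  \<open>1 - x + x\<^sup>2\<close>, equals \<open>1 + (x\<^sup>2 + x^3 + x^4) / 2\<close> and so is
  at least 1.\<close>

lemma exp_le_quadratic:
  fixes y :: real
  assumes "y \<le> 1"
  shows "exp y \<le> 1 + y + y\<^sup>2"
proof (cases "0 \<le> y")
  case True
  then show ?thesis using assms by (rule exp_bound)
next
  case False
  define x where "x = - y"
  have x: "x > 0" using False by (simp add: x_def)
  have pos: "0 < 1 - x + x\<^sup>2"
  proof -
    have "1 - x + x\<^sup>2 = (x - 1/2)\<^sup>2 + 3/4" by (simp add: power2_eq_square algebra_simps)
    then show ?thesis by (simp add: add_nonneg_pos)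
  qed
  have "1 \<le> 1 + (x\<^sup>2 + x^3 + x^4) / 2" using x by simp
  also have "\<dots> = (1 + x + x\<^sup>2 / 2) * (1 - x + x\<^sup>2)"
    by (simp add: field_simps power2_eq_square power3_eq_cube power4_eq_xxxx)
  also have "\<dots> \<le> exp x * (1 - x + x\<^sup>2)"
    using exp_lower_Taylor_quadratic[of x] x pos by (intro mult_right_mono) auto
  finally have "exp (- x) \<le> 1 - x + x\<^sup>2"
    by (simp add: exp_minus field_simps)
  then show ?thesis by (simp add: x_def)
qed

subsection \<open>Clipping\<close>

lemma norm_clip_le:
  assumes "0 \<le> lam"
  shows "norm (clip y lam) \<le> lam"
  using assms by (auto simp: clip_def min_def field_simps)

text \<open>A point outside the ball is rescaled onto the sphere, which is the metric projection.
  This makes the nonexpansiveness of projections available.\<close>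

lemma clip_eq_closest_point:
  fixes y :: "real ^ 'd"
  assumes "0 < lam"
  shows "clip y lam = closest_point (cball 0 lam) y"
proof (rule closest_point_unique)
  show "clip y lam \<in> cball 0 lam"
    using norm_clip_le[of lam y] assms by simp
  show "\<forall>z\<in>cball 0 lam. dist y (clip y lam) \<le> dist y z"
  proof
    fix z :: "real ^ 'd" assume z: "z \<in> cball 0 lam"
    show "dist y (clip y lam) \<le> dist y z"
    proof (cases "norm y \<le> lam")
      case True
      then show ?thesis using assms by (auto simp: clip_def min_def field_simps)
    next
      case False
      then have y: "y \<noteq> 0" "lam / norm y < 1" using assms by (auto simp: divide_less_eq)
      have "y - clip y lam = (1 - lam / norm y) *\<^sub>R y"
        using y by (simp add: clip_def algebra_simps)
      then have "dist y (clip y lam) = (1 - lam / norm y) * norm y"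
        using y by (simp add: dist_norm)
      also have "\<dots> = norm y - lam" using y by (simp add: field_simps)
      also have "\<dots> \<le> norm y - norm z" using z by simp
      also have "\<dots> \<le> dist y z" by (metis dist_norm norm_triangle_ineq2)
      finally show ?thesis .
    qed
  qed
qed auto

text \<open>The projection is nonexpansive and fixes \<open>f\<close>. For \<open>f = F x\<close>,
  clipping a batch mean therefore does not increase its second moment about
  \<open>F x\<close>.\<close>

lemma norm_clip_diff_le:
  assumes "0 < lam" "norm f \<le> lam"
  shows "norm (clip y lam - f) \<le> norm (y - f)"
proof -
  have "dist (closest_point (cball 0 lam) y) (closest_point (cball 0 lam) f) \<le> dist y f"
    using assms by (intro closest_point_lipschitz) auto
  moreover have "closest_point (cball 0 lam) f = f"
    using assms by (intro closest_point_self) simp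
  ultimately show ?thesis
    using assms by (simp add: clip_eq_closest_point dist_norm)
qed

text \<open>The distance to the ball is at most \<open>n - b\<close> with \<open>n = norm (y - f)\<close>, and \<open>n - b \<le> n\<^sup>2 / (4 * b)\<close>.\<close>

lemma norm_clip_self_diff_le:
  assumes "0 < b" "norm f + b \<le> lam"
  shows "norm (clip y lam - y) \<le> (norm (y - f))\<^sup>2 / (4 * b)"
proof (cases "norm y \<le> lam")
  case True
  have "0 < lam" using assms norm_ge_zero[of f] by linarith
  then have "clip y lam = y"
    using True by (auto simp: clip_def min_def field_simps)
  then show ?thesis using assms by simp
next
  case False
  have lam: "0 < lam" using assms norm_ge_zero[of f] by linarith
  have y: "y \<noteq> 0" "lam / norm y < 1" using False lam by (auto simp: divide_less_eq)
  have "clip y lam - y = - ((1 - lam / norm y) *\<^sub>R y)"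
    using y by (simp add: clip_def algebra_simps)
  then have "norm (clip y lam - y) = (1 - lam / norm y) * norm y"
    using y by simp
  also have "\<dots> = norm y - lam" using y by (simp add: field_simps)
  also have "\<dots> \<le> norm (y - f) - b"
    using assms norm_triangle_ineq2[of y f] by simp
  also have "\<dots> \<le> (norm (y - f))\<^sup>2 / (4 * b)"
  proof -
    have "0 \<le> (norm (y - f) - 2 * b)\<^sup>2" by simp
    then show ?thesis using assms(1) by (simp add: field_simps power2_eq_square)
  qed
  finally show ?thesis .
qed

lemma clip_measurable [measurable]: "(\<lambda>y. clip y lam) \<in> borel_measurable borel"
  unfolding clip_def by measurable

subsection \<open>Moments of random vectors\<close>

text \<open>The inner product is a finite sum of coordinate products over \<open>Basis\<close>, and
  the scalar product rule for independent variables applies to each.\<close>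

lemma (in prob_space)
  fixes X Y :: "'a \<Rightarrow> 'b :: euclidean_space"
  assumes ind: "indep_var borel X borel Y" and int: "integrable M X" "integrable M Y"
  shows indep_var_integrable_inner: "integrable M (\<lambda>\<omega>. X \<omega> \<bullet> Y \<omega>)"
    and indep_var_expectation_inner:
      "expectation (\<lambda>\<omega>. X \<omega> \<bullet> Y \<omega>) = expectation X \<bullet> expectation Y"
proof -
  have ind': "indep_var borel (\<lambda>\<omega>. X \<omega> \<bullet> b) borel (\<lambda>\<omega>. Y \<omega> \<bullet> b)" for b
    using indep_var_compose[OF ind, of "\<lambda>v. v \<bullet> b" borel "\<lambda>v. v \<bullet> b" borel]
    by (simp add: comp_def)
  have intb: "integrable M (\<lambda>\<omega>. X \<omega> \<bullet> b)" "integrable M (\<lambda>\<omega>. Y \<omega> \<bullet> b)" for b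
    using int by auto
  have i: "integrable M (\<lambda>\<omega>. (X \<omega> \<bullet> b) * (Y \<omega> \<bullet> b))" for b
    by (rule indep_var_integrable[OF ind' intb])
  have e: "expectation (\<lambda>\<omega>. (X \<omega> \<bullet> b) * (Y \<omega> \<bullet> b)) = (expectation X \<bullet> b) * (expectation Y \<bullet> b)" for b
    using indep_var_lebesgue_integral[OF ind' intb] int by simp
  show "integrable M (\<lambda>\<omega>. X \<omega> \<bullet> Y \<omega>)"
    by (subst euclidean_inner) (use i in auto)
  have "expectation (\<lambda>\<omega>. X \<omega> \<bullet> Y \<omega>) = expectation (\<lambda>\<omega>. \<Sum>b\<in>Basis. (X \<omega> \<bullet> b) * (Y \<omega> \<bullet> b))"
    by (simp add: euclidean_inner[of "X _" "Y _"])
  also have "\<dots> = expectation X \<bullet> expectation Y"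
    by (simp add: i e euclidean_inner[of "expectation X" "expectation Y"])
  finally show "expectation (\<lambda>\<omega>. X \<omega> \<bullet> Y \<omega>) = expectation X \<bullet> expectation Y" .
qed

text \<open>The squared norm of the centred sum is a double sum. Independence kills the off-diagonal
  terms, and the \<open>card I\<close> diagonal terms, each at most \<open>v\<close>, meet the
  factor \<open>1 / (card I)\<^sup>2\<close>.\<close>

lemma (in prob_space)
  fixes X :: "'i \<Rightarrow> 'a \<Rightarrow> 'b :: euclidean_space"
  assumes I: "finite I" "I \<noteq> {}" and ind: "indep_vars (\<lambda>_. borel) X I"
    and int: "\<And>i. i \<in> I \<Longrightarrow> integrable M (X i)"
    and mean: "\<And>i. i \<in> I \<Longrightarrow> expectation (X i) = f"
    and int2: "\<And>i. i \<in> I \<Longrightarrow> integrable M (\<lambda>\<omega>. (norm (X i \<omega> - f))\<^sup>2)"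
    and var: "\<And>i. i \<in> I \<Longrightarrow> expectation (\<lambda>\<omega>. (norm (X i \<omega> - f))\<^sup>2) \<le> v"
  shows integrable_sample_mean_diff_sq:
      "integrable M (\<lambda>\<omega>. (norm ((1 / real (card I)) *\<^sub>R (\<Sum>i\<in>I. X i \<omega>) - f))\<^sup>2)"
    and expectation_sample_mean_diff_sq_le:
      "expectation (\<lambda>\<omega>. (norm ((1 / real (card I)) *\<^sub>R (\<Sum>i\<in>I. X i \<omega>) - f))\<^sup>2) \<le> v / real (card I)"
proof -
  define Z where "Z = (\<lambda>i \<omega>. X i \<omega> - f)"
  define n where "n = real (card I)"
  have n: "n > 0" using I by (simp add: n_def card_gt_0_iff)
  have intZ: "integrable M (Z i)" if "i \<in> I" for i
    using int[OF that] by (simp add: Z_def)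
  have meanZ: "expectation (Z i) = 0" if "i \<in> I" for i
    using int[OF that] mean[OF that] by (simp add: Z_def prob_space)
  have indZ: "indep_vars (\<lambda>_. borel) Z I"
    unfolding Z_def by (rule indep_vars_compose2[OF ind]) simp
  have pair: "integrable M (\<lambda>\<omega>. Z i \<omega> \<bullet> Z j \<omega>) \<and>
      expectation (\<lambda>\<omega>. Z i \<omega> \<bullet> Z j \<omega>) \<le> (if i = j then v else 0)" if "i \<in> I" "j \<in> I" for i j
  proof (cases "i = j")
    case True
    then show ?thesis using int2 var that by (simp add: Z_def power2_norm_eq_inner)
  next
    case False
    have "indep_var borel (Z i) borel (Z j)"
      using indep_var_compose[OF indep_var_restrict[OF indZ, of "{i}" "{j}"],
          of "\<lambda>f. f i" borel "\<lambda>f. f j" borel] that False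
      by (simp add: comp_def)
    then show ?thesis
      using indep_var_integrable_inner[of "Z i" "Z j"] indep_var_expectation_inner[of "Z i" "Z j"]
        intZ meanZ that False by simp
  qed
  have eq: "(norm ((1 / real (card I)) *\<^sub>R (\<Sum>i\<in>I. X i \<omega>) - f))\<^sup>2
      = (1 / n\<^sup>2) * (\<Sum>i\<in>I. \<Sum>j\<in>I. Z i \<omega> \<bullet> Z j \<omega>)" for \<omega>
  proof -
    have "(1 / n) *\<^sub>R (\<Sum>i\<in>I. X i \<omega>) - f = (1 / n) *\<^sub>R (\<Sum>i\<in>I. Z i \<omega>)"
      using n by (simp add: Z_def sum_subtractf n_def scaleR_diff_right sum_constant_scaleR)
    then have "(norm ((1 / n) *\<^sub>R (\<Sum>i\<in>I. X i \<omega>) - f))\<^sup>2 = (1 / n\<^sup>2) * ((\<Sum>i\<in>I. Z i \<omega>) \<bullet> (\<Sum>i\<in>I. Z i \<omega>))"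
      by (simp add: dot_square_norm power_divide)
    also have "(\<Sum>i\<in>I. Z i \<omega>) \<bullet> (\<Sum>i\<in>I. Z i \<omega>) = (\<Sum>i\<in>I. \<Sum>j\<in>I. Z i \<omega> \<bullet> Z j \<omega>)"
      unfolding inner_sum_left by (intro sum.cong refl inner_sum_right)
    finally show ?thesis by (simp add: n_def)
  qed
  show "integrable M (\<lambda>\<omega>. (norm ((1 / real (card I)) *\<^sub>R (\<Sum>i\<in>I. X i \<omega>) - f))\<^sup>2)"
    unfolding eq using pair by (intro integrable_mult_right Bochner_Integration.integrable_sum) auto
  have "expectation (\<lambda>\<omega>. (norm ((1 / real (card I)) *\<^sub>R (\<Sum>i\<in>I. X i \<omega>) - f))\<^sup>2)
      = (1 / n\<^sup>2) * (\<Sum>i\<in>I. \<Sum>j\<in>I. expectation (\<lambda>\<omega>. Z i \<omega> \<bullet> Z j \<omega>))"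
    unfolding eq using pair by (simp add: Bochner_Integration.integral_sum)
  also have "\<dots> \<le> (1 / n\<^sup>2) * (\<Sum>i\<in>I. \<Sum>j\<in>I. if i = j then v else 0)"
    using pair by (intro mult_left_mono sum_mono) auto
  also have "\<dots> = v / real (card I)"
    using n I by (simp add: n_def[symmetric] sum.delta field_simps power2_eq_square)
  finally show "expectation (\<lambda>\<omega>. (norm ((1 / real (card I)) *\<^sub>R (\<Sum>i\<in>I. X i \<omega>) - f))\<^sup>2) \<le> v / real (card I)" .
qed

text \<open>The condition on \<open>t\<close> keeps the exponent at most 1 in absolute value, so
  \<open>exp_le_quadratic\<close> reduces the claim to two moments of the exponent. In the mean, the
  inner product sees only the bias \<open>d\<close>; the second moment is controlled by
  \<open>v\<close>, because the bound \<open>B\<close> makes the exponent at most linear in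
  \<open>norm (e \<omega>)\<close>.\<close>

lemma (in prob_space) nn_integral_exp_inner_plus_sq_le:
  fixes e :: "'a \<Rightarrow> 'b :: euclidean_space"
  assumes [measurable]: "e \<in> borel_measurable M"
    and B: "\<And>\<omega>. \<omega> \<in> space M \<Longrightarrow> norm (e \<omega>) \<le> B" "0 \<le> B"
    and v: "expectation (\<lambda>\<omega>. (norm (e \<omega>))\<^sup>2) \<le> v"
    and bias: "norm (expectation e) \<le> d"
    and a: "norm a \<le> r"
    and t: "0 \<le> t" "t * (2 * r * B + 3 * B\<^sup>2) \<le> 1"
  shows "(\<integral>\<^sup>+\<omega>. ennreal (exp (t * (2 * (a \<bullet> e \<omega>) + 3 * (norm (e \<omega>))\<^sup>2))) \<partial>M)
    \<le> ennreal (exp (t * (2 * r * d + 3 * v) + t\<^sup>2 * (2 * r + 3 * B)\<^sup>2 * v))"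
proof -
  define Y where "Y = (\<lambda>\<omega>. 2 * (a \<bullet> e \<omega>) + 3 * (norm (e \<omega>))\<^sup>2)"
  have [measurable]: "Y \<in> borel_measurable M" unfolding Y_def by measurable
  have r: "0 \<le> r" using a norm_ge_zero order_trans by blast
  have ae: "\<bar>a \<bullet> e \<omega>\<bar> \<le> r * norm (e \<omega>)" for \<omega>
    by (rule order_trans[OF Cauchy_Schwarz_ineq2]) (intro mult_right_mono a norm_ge_zero)
  have absY: "\<bar>Y \<omega>\<bar> \<le> (2 * r + 3 * B) * norm (e \<omega>)" if "\<omega> \<in> space M" for \<omega>
  proof -
    have "\<bar>Y \<omega>\<bar> \<le> 2 * (r * norm (e \<omega>)) + 3 * (norm (e \<omega>) * norm (e \<omega>))"
      using ae[of \<omega>] zero_le_square[of "norm (e \<omega>)"]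
      unfolding Y_def power2_eq_square by linarith
    also have "\<dots> \<le> 2 * (r * norm (e \<omega>)) + 3 * (B * norm (e \<omega>))"
      using B(1)[OF that] by (intro add_left_mono mult_left_mono mult_right_mono) auto
    finally show ?thesis by (simp add: algebra_simps)
  qed
  have absY': "\<bar>Y \<omega>\<bar> \<le> 2 * r * B + 3 * B\<^sup>2" if "\<omega> \<in> space M" for \<omega>
  proof -
    have "\<bar>Y \<omega>\<bar> \<le> (2 * r + 3 * B) * norm (e \<omega>)" by (rule absY[OF that])
    also have "\<dots> \<le> (2 * r + 3 * B) * B" using B(1)[OF that] r B(2) by (intro mult_left_mono) auto
    finally show ?thesis by (simp add: algebra_simps power2_eq_square)
  qed
  have tY: "\<bar>t * Y \<omega>\<bar> \<le> 1" if "\<omega> \<in> space M" for \<omega>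
    using mult_left_mono[OF absY'[OF that] t(1)] t by (simp add: abs_mult)
  have int_e: "integrable M e"
    by (rule integrable_const_bound[of _ B]) (use B in auto)
  have int_e2: "integrable M (\<lambda>\<omega>. (norm (e \<omega>))\<^sup>2)"
    by (rule integrable_const_bound[of _ "B\<^sup>2"]) (use B in \<open>auto intro!: power_mono\<close>)
  have int_Y: "integrable M Y" unfolding Y_def using int_e int_e2 by auto
  have int_Y2: "integrable M (\<lambda>\<omega>. (Y \<omega>)\<^sup>2)"
    by (rule integrable_const_bound[of _ "(2 * r * B + 3 * B\<^sup>2)\<^sup>2"])
      (use absY' in \<open>auto simp: abs_le_square_iff[symmetric] intro!: AE_I2 order_trans[OF _ abs_ge_self]\<close>)
  have int_exp: "integrable M (\<lambda>\<omega>. exp (t * Y \<omega>))"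
    by (rule integrable_const_bound[of _ "exp 1"]) (use tY in \<open>auto simp: abs_le_iff\<close>)
  have EY: "expectation Y \<le> 2 * r * d + 3 * v"
  proof -
    have "expectation Y = 2 * (a \<bullet> expectation e) + 3 * expectation (\<lambda>\<omega>. (norm (e \<omega>))\<^sup>2)"
      unfolding Y_def using int_e int_e2 by simp
    moreover have "a \<bullet> expectation e \<le> r * d"
      using norm_cauchy_schwarz[of a "expectation e"] mult_mono[OF a bias r norm_ge_zero] by linarith
    ultimately show ?thesis using v by simp
  qed
  have EY2: "expectation (\<lambda>\<omega>. (Y \<omega>)\<^sup>2) \<le> (2 * r + 3 * B)\<^sup>2 * v"
  proof -
    have "expectation (\<lambda>\<omega>. (Y \<omega>)\<^sup>2) \<le> expectation (\<lambda>\<omega>. (2 * r + 3 * B)\<^sup>2 * (norm (e \<omega>))\<^sup>2)"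
    proof (rule integral_mono)
      fix \<omega> assume "\<omega> \<in> space M"
      from absY[OF this] have "\<bar>Y \<omega>\<bar>\<^sup>2 \<le> ((2 * r + 3 * B) * norm (e \<omega>))\<^sup>2"
        by (intro power_mono) auto
      then show "(Y \<omega>)\<^sup>2 \<le> (2 * r + 3 * B)\<^sup>2 * (norm (e \<omega>))\<^sup>2" by (simp add: power_mult_distrib)
    qed (use int_Y2 int_e2 in auto)
    also have "\<dots> \<le> (2 * r + 3 * B)\<^sup>2 * v" using v by (simp add: mult_left_mono)
    finally show ?thesis .
  qed
  have "expectation (\<lambda>\<omega>. exp (t * Y \<omega>)) \<le> expectation (\<lambda>\<omega>. 1 + t * Y \<omega> + t\<^sup>2 * (Y \<omega>)\<^sup>2)"
  proof (rule integral_mono)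
    fix \<omega> assume "\<omega> \<in> space M"
    from tY[OF this] show "exp (t * Y \<omega>) \<le> 1 + t * Y \<omega> + t\<^sup>2 * (Y \<omega>)\<^sup>2"
      using exp_le_quadratic[of "t * Y \<omega>"] by (simp add: power_mult_distrib)
  qed (use int_exp int_Y int_Y2 in auto)
  also have "\<dots> = 1 + t * expectation Y + t\<^sup>2 * expectation (\<lambda>\<omega>. (Y \<omega>)\<^sup>2)"
    using int_Y int_Y2 by (simp add: prob_space)
  also have "\<dots> \<le> 1 + (t * (2 * r * d + 3 * v) + t\<^sup>2 * ((2 * r + 3 * B)\<^sup>2 * v))"
    using mult_left_mono[OF EY t(1)] mult_left_mono[OF EY2, of "t\<^sup>2"] by simp
  also have "\<dots> \<le> exp (t * (2 * r * d + 3 * v) + t\<^sup>2 * (2 * r + 3 * B)\<^sup>2 * v)"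
    by (metis exp_ge_add_one_self mult.assoc)
  finally show ?thesis
    using nn_integral_eq_integral[OF int_exp] by (simp add: Y_def)
qed

subsection \<open>Measurable approximate projections\<close>

text \<open>A nearest point cannot be chosen measurably without a selection theorem, but an approximate one
  can: take the first suitable point of a countable dense subset of \<open>S\<close>.\<close>

lemma measurable_approx_projection:
  fixes S :: "'a :: euclidean_space set" and f :: "'a \<Rightarrow> 'a" and h :: "'a \<Rightarrow> real"
  assumes S: "S \<noteq> {}" and [measurable]: "f \<in> borel_measurable borel" "h \<in> borel_measurable borel"
    and \<delta>: "0 < \<delta>"
  obtains p where "p \<in> borel_measurable borel" and "\<And>x. p x \<in> S"
    and "\<And>x q. q \<in> S \<Longrightarrow> norm (x - q) = infdist x S \<Longrightarrow> h x \<le> f x \<bullet> (x - q) \<Longrightarrow>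
      (norm (x - p x))\<^sup>2 \<le> (infdist x S)\<^sup>2 + \<delta> \<and> h x - \<delta> \<le> f x \<bullet> (x - p x)"
proof -
  obtain T where T: "countable T" "T \<subseteq> S" "S \<subseteq> closure T" by (rule separable)
  have T0: "T \<noteq> {}" using S T(3) by auto
  define s where "s = from_nat_into T"
  define ok where "ok n x \<longleftrightarrow> (norm (x - s n))\<^sup>2 < (infdist x S)\<^sup>2 + \<delta> \<and> h x - \<delta> < f x \<bullet> (x - s n)" for n x
  have [measurable]: "(\<lambda>x. infdist x S) \<in> borel_measurable borel"
    by (intro borel_measurable_continuous_onI continuous_on_infdist continuous_on_id)
  have [measurable]: "Measurable.pred borel (ok n)" for n
    unfolding ok_def by measurable
  have 1: "(\<lambda>x. s (LEAST n. ok n x)) \<in> borel_measurable borel"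
    by (rule measurable_compose[of _ _ "count_space UNIV"]) measurable
  \<comment> \<open>This holds for every index, so the chosen point lies in \<open>S\<close> even
    where no index is suitable and \<open>LEAST\<close> returns an unspecified value.\<close>
  have 2: "s n \<in> S" for n
    using from_nat_into[OF T0] T(2) by (auto simp: s_def)
  have 3: "ok (LEAST n. ok n x) x"
    if q: "q \<in> S" "norm (x - q) = infdist x S" "h x \<le> f x \<bullet> (x - q)" for x q
  proof (rule LeastI_ex)
    define U where "U = {z. (norm (x - z))\<^sup>2 < (infdist x S)\<^sup>2 + \<delta>} \<inter> {z. h x - \<delta> < f x \<bullet> (x - z)}"
    \<comment> \<open>Strict inequalities make \<open>U\<close> open, and
      \<open>0 < \<delta>\<close> puts \<open>q\<close> into it; hence the dense set
      \<open>T\<close> meets \<open>U\<close>.\<close>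
    have "open U" unfolding U_def
      by (intro open_Int open_Collect_less continuous_intros)
    moreover have "q \<in> U" using q \<delta> by (simp add: U_def)
    moreover have "q \<in> closure T" using q(1) T(3) by auto
    ultimately have "U \<inter> T \<noteq> {}"
      using open_Int_closure_eq_empty[of U T] by blast
    then obtain z where "z \<in> U" "z \<in> T" by auto
    moreover have "s (to_nat_on T z) = z"
      using \<open>z \<in> T\<close> T(1) by (simp add: s_def)
    ultimately have "ok (to_nat_on T z) x" by (simp add: ok_def U_def)
    then show "\<exists>n. ok n x" ..
  qed
  show thesis
    by (rule that[OF 1 2]) (use 3 in \<open>auto simp: ok_def intro: less_imp_le\<close>)
qed

lemma is_projection_imp_infdist:
  assumes "is_projection S x q"
  shows "norm (x - q) = infdist x S"
proof (rule antisym)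
  have q: "q \<in> S" "\<And>z. z \<in> S \<Longrightarrow> norm (x - q) \<le> norm (x - z)"
    using assms by (auto simp: is_projection_def)
  show "infdist x S \<le> norm (x - q)"
    using infdist_le[OF q(1), of x] by (simp add: dist_norm)
  have "S \<noteq> {}" using q(1) by auto
  then show "norm (x - q) \<le> infdist x S"
    unfolding infdist_def using q(2) by (auto intro!: cINF_greatest simp: dist_norm)
qed

text \<open>The states used below carry \<open>borel\<close> on a product type, where the
  projections are measurable by continuity.\<close>

lemma fst_borel_measurable [measurable]:
  "fst \<in> borel_measurable (borel :: ('a :: topological_space \<times> 'b :: topological_space) measure)"
  and snd_borel_measurable [measurable]:
  "snd \<in> borel_measurable (borel :: ('a :: topological_space \<times> 'b :: topological_space) measure)"
  by (auto intro!: borel_measurable_continuous_onI continuous_intros)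

text \<open>The operator is an integral depending on a parameter, so joint measurability of the
  oracle suffices.\<close>

lemma mean_operator_measurable:
  assumes "prob_space D" and [measurable]: "(\<lambda>(s, x). G s x) \<in> borel_measurable (D \<Otimes>\<^sub>M borel)"
  shows "mean_operator D G \<in> borel_measurable borel"
proof -
  interpret D: prob_space D by fact
  have "(\<lambda>(x, s). G s x) \<in> borel_measurable (borel \<Otimes>\<^sub>M D)"
    using measurable_compose[OF measurable_pair_swap' assms(2)] by (simp add: case_prod_beta)
  then show ?thesis
    unfolding mean_operator_def by (rule D.borel_measurable_lebesgue_integral)
qed

subsection \<open>The Lyapunov function\<close>

text \<open>Here \<open>A\<close> stands for \<open>log_factor \<beta> K\<close> and
  \<open>n\<close> for \<open>K + 1\<close>; \<open>stepsize\<close> and \<open>batch\<close> are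
  conditions (a) and (b) with denominators cleared. The map \<open>p\<close> is a measurable
  near-projection onto the solution set, and \<open>\<delta>\<close> is so small that the errors of
  all \<open>n\<close> steps add up to at most \<open>R\<^sup>2\<close>.\<close>

locale clipped_SGDA_run =
  fixes M :: "'w measure" and D :: "'s measure" and G :: "'s \<Rightarrow> real ^ 'd \<Rightarrow> real ^ 'd"
    and \<xi> x0 xstar proj and l R \<sigma> A \<gamma> lam :: real and n m :: nat and p and \<delta> :: real
  assumes problem: "SGDA_problem l R \<sigma> M D G \<xi> x0 xstar proj"
    and l: "0 < l" and R: "0 < R" and A: "1 \<le> A" and \<gamma>: "0 < \<gamma>"
    and stepsize: "170 * l * \<gamma> * A \<le> 1"
    and n: "1 \<le> n" and m: "1 \<le> m"
    and batch: "97200 * real n * \<gamma>\<^sup>2 * \<sigma>\<^sup>2 * A \<le> real m * R\<^sup>2"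
    and lam: "lam = R / (60 * \<gamma> * A)"
    and p_measurable [measurable]: "p \<in> borel_measurable borel"
    and p_solution: "\<And>x. p x \<in> solution_set (mean_operator D G)"
    and p_near: "\<And>x. x \<in> cball xstar (2 * R) \<Longrightarrow>
      (norm (x - p x))\<^sup>2 \<le> (infdist x (solution_set (mean_operator D G)))\<^sup>2 + \<delta>"
    and p_coercive: "\<And>x. x \<in> cball xstar (2 * R) \<Longrightarrow>
      (norm (mean_operator D G x))\<^sup>2 / l - \<delta> \<le> mean_operator D G x \<bullet> (x - p x)"
    and \<delta>: "0 < \<delta>" "real n * (\<delta> * (1 + 2 * \<gamma>)) \<le> R\<^sup>2"
begin

section \<open>The operator on the ball \<open>Q\<close>\<close>

abbreviation "F \<equiv> mean_operator D G"
abbreviation "S \<equiv> solution_set F"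
abbreviation "Q \<equiv> cball xstar (2 * R)"

lemma
  shows M: "prob_space M" and D: "prob_space D"
    and G_measurable: "(\<lambda>(s, x). G s x) \<in> borel_measurable (D \<Otimes>\<^sub>M borel)"
    and G_integrable: "integrable D (\<lambda>s. G s x)"
    and indep: "prob_space.indep_vars M (\<lambda>_. D) (\<lambda>(i, k). \<xi> i k) UNIV"
    and distr: "distr M D (\<xi> i k) = D"
    and xstar_proj: "is_projection S x0 xstar" and x0: "norm (x0 - xstar) \<le> R"
    and var_integrable: "x \<in> Q \<Longrightarrow> integrable D (\<lambda>s. (norm (G s x - F x))\<^sup>2)"
    and var_le: "x \<in> Q \<Longrightarrow> (\<integral>s. (norm (G s x - F x))\<^sup>2 \<partial>D) \<le> \<sigma>\<^sup>2"
    and monotone: "\<lbrakk>x \<in> Q; u \<in> Q\<rbrakk> \<Longrightarrow> F u \<bullet> (x - u) \<le> F x \<bullet> (x - u)"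
    and coercive: "x \<in> Q \<Longrightarrow> (norm (F x))\<^sup>2 \<le> l * (F x \<bullet> (x - proj x))"
    and proj: "x \<in> Q \<Longrightarrow> is_projection S x (proj x)"
  using problem
  by (auto simp: SGDA_problem_def Let_def sampled_oracle_def bounded_variance_on_def
      monotone_operator_on_def star_cocoercive_on_def inner_diff_left)

lemma xstar_solution: "xstar \<in> S" "F xstar = 0"
  using xstar_proj by (auto simp: is_projection_def solution_set_def)

text \<open>Cauchy-Schwarz turns star-cocoercivity into a bound by the distance to
  \<open>proj x\<close>, which is at most the distance to the solution \<open>xstar\<close>.\<close>

lemma norm_F_le:
  assumes "x \<in> Q"
  shows "norm (F x) \<le> l * norm (x - xstar)"
proof (cases "F x = 0")
  case False
  have "norm (F x) * norm (F x) \<le> l * (F x \<bullet> (x - proj x))"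
    using coercive[OF assms] by (simp add: power2_eq_square)
  also have "\<dots> \<le> l * (norm (F x) * norm (x - proj x))"
    using l by (intro mult_left_mono norm_cauchy_schwarz) auto
  finally have "norm (F x) \<le> l * norm (x - proj x)"
    using False by (simp add: mult.left_commute)
  also have "\<dots> \<le> l * norm (x - xstar)"
    using proj[OF assms] xstar_solution l by (auto simp: is_projection_def)
  finally show ?thesis .
qed (use l in simp)

lemma \<gamma>_norm_F_le:
  assumes "x \<in> Q"
  shows "\<gamma> * norm (F x) \<le> R / (85 * A)"
proof -
  have "l * norm (x - xstar) \<le> l * (2 * R)"
    using assms l by (simp add: dist_norm norm_minus_commute)
  with norm_F_le[OF assms] have "norm (F x) \<le> l * (2 * R)" by simp
  then have "\<gamma> * norm (F x) \<le> \<gamma> * (l * (2 * R))" using \<gamma> by (intro mult_left_mono) auto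
  also have "\<dots> \<le> R / (85 * A)"
    using mult_right_mono[OF stepsize, of R] R A by (simp add: field_simps)
  finally show ?thesis .
qed

section \<open>The noise and the stopped state process\<close>

definition noise :: "real ^ 'd \<Rightarrow> real ^ 'd \<Rightarrow> real ^ 'd" where
  "noise x y = \<gamma> *\<^sub>R (F x - clip y lam)"

text \<open>This vector is multiplied by \<open>2 * e\<close> when the Lyapunov function is
  expanded. The first summand combines \<open>(norm (x - u))\<^sup>2\<close> with
  \<open>- 2 * ((xstar - u) \<bullet> W)\<close>, which cancels \<open>u\<close>; the other two come
  from \<open>(norm W)\<^sup>2\<close> and from the squared distance to \<open>S\<close>.\<close>

definition direction :: "real ^ 'd \<Rightarrow> real ^ 'd \<Rightarrow> real ^ 'd" where
  "direction x W = (x - xstar - \<gamma> *\<^sub>R F x) + W + (x - p x - \<gamma> *\<^sub>R F x)"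

text \<open>The factor 3 counts the three squares, each contributing one
  \<open>(norm e)\<^sup>2\<close>.\<close>

definition increment :: "real ^ 'd \<Rightarrow> real ^ 'd \<Rightarrow> real ^ 'd \<Rightarrow> real" where
  "increment x W e = 2 * (direction x W \<bullet> e) + 3 * (norm e)\<^sup>2"

definition batch_mean :: "(nat \<Rightarrow> 's) \<Rightarrow> real ^ 'd \<Rightarrow> real ^ 'd" where
  "batch_mean b x = (1 / real m) *\<^sub>R (\<Sum>i=1..m. G (b i) x)"

definition active :: "(real ^ 'd) \<times> (real ^ 'd) \<times> real \<Rightarrow> bool" where
  "active = (\<lambda>(x, W, Z). x \<in> Q \<and> norm W \<le> 2 * R)"

text \<open>The state consists of the iterate, the sum \<open>W\<close> of the noise vectors, and a scalar \<open>Z\<close> that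
  bounds the growth of the Lyapunov function. It is frozen when it leaves the active region, which
  replaces a stopping time.\<close>

definition step :: "(real ^ 'd) \<times> (real ^ 'd) \<times> real \<Rightarrow> (nat \<Rightarrow> 's) \<Rightarrow> (real ^ 'd) \<times> (real ^ 'd) \<times> real" where
  "step st b = (case st of (x, W, Z) \<Rightarrow>
     if active st then
       let e = noise x (batch_mean b x)
       in (x - \<gamma> *\<^sub>R F x + e, W + e, Z + increment x W e)
     else st)"

primrec path :: "(nat \<Rightarrow> nat \<Rightarrow> 's) \<Rightarrow> nat \<Rightarrow> (real ^ 'd) \<times> (real ^ 'd) \<times> real" where
  "path s 0 = (x0, 0, 0)"
| "path s (Suc k) = step (path s k) (\<lambda>i. s i k)"

abbreviation "xpath s k \<equiv> fst (path s k)"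
abbreviation "Wpath s k \<equiv> fst (snd (path s k))"
abbreviation "Zpath s k \<equiv> snd (snd (path s k))"

section \<open>Growth of the Lyapunov function along a path\<close>

lemma path_frozen:
  assumes "\<not> active (path s k)" "k \<le> j"
  shows "path s j = path s k"
  using assms(2) by (induction rule: dec_induct) (auto simp: step_def assms(1) split: prod.split)

text \<open>By freezing, a bound on the final state alone controls the whole path.\<close>

lemma active_mono:
  assumes "active (path s j)" "k \<le> j"
  shows "active (path s k)"
  using path_frozen[OF _ assms(2)] assms(1) by metis

text \<open>Subtracting \<open>Z\<close> makes the growth estimate deterministic. The term
  \<open>(norm W)\<^sup>2\<close> serves twice: for \<open>u = xstar\<close> it keeps
  \<open>W\<close> bounded, and for general \<open>u\<close> it completes the square with
  \<open>- 2 * ((xstar - u) \<bullet> W)\<close>.\<close>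

definition lyapunov :: "real ^ 'd \<Rightarrow> (real ^ 'd) \<times> (real ^ 'd) \<times> real \<Rightarrow> real" where
  "lyapunov u = (\<lambda>(x, W, Z). (norm (x - u))\<^sup>2 - 2 * ((xstar - u) \<bullet> W) + (norm W)\<^sup>2 + (infdist x S)\<^sup>2 - Z)"

text \<open>The squares about \<open>u\<close> and about \<open>p x\<close> each leave
  \<open>\<gamma>\<^sup>2 * (norm (F x))\<^sup>2\<close>. As \<open>l * \<gamma> \<le> 1\<close>,
  the descent term of the second square absorbs both up to \<open>2 * \<gamma> * \<delta>\<close>; a
  further \<open>\<delta>\<close> is lost because \<open>p x\<close> is only nearly nearest. The
  noise terms add up exactly to \<open>increment\<close>.\<close>

lemma lyapunov_step:
  assumes "active st"
  shows "lyapunov u (step st b) + 2 * \<gamma> * (F (fst st) \<bullet> (fst st - u)) \<le> lyapunov u st + \<delta> * (1 + 2 * \<gamma>)"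
proof -
  obtain x W Z where st: "st = (x, W, Z)" by (cases st)
  have x: "x \<in> Q" using assms by (simp add: active_def st)
  define f where "f = F x"
  define e where "e = noise x (batch_mean b x)"
  define y where "y = x - \<gamma> *\<^sub>R f + e"
  have sq: "(norm (y - z))\<^sup>2 = (norm (x - z))\<^sup>2 - 2 * \<gamma> * (f \<bullet> (x - z)) + \<gamma>\<^sup>2 * (norm f)\<^sup>2
      + 2 * ((x - z - \<gamma> *\<^sub>R f) \<bullet> e) + (norm e)\<^sup>2" for z
    unfolding y_def power2_norm_eq_inner
    by (simp add: inner_simps inner_commute power2_eq_square algebra_simps)
  \<comment> \<open>Any solution bounds the distance from above, so the point chosen for
    \<open>x\<close> also serves the next iterate \<open>y\<close>.\<close>
  have "(infdist y S)\<^sup>2 \<le> (norm (y - p x))\<^sup>2"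
    using infdist_le[OF p_solution[of x], of y] by (intro power_mono) (auto simp: dist_norm infdist_nonneg)
  moreover have "(norm (x - p x))\<^sup>2 \<le> (infdist x S)\<^sup>2 + \<delta>" by (rule p_near[OF x])
  moreover have "\<gamma>\<^sup>2 * (norm f)\<^sup>2 \<le> \<gamma> * (f \<bullet> (x - p x)) + \<gamma> * \<delta>"
  proof -
    have "l * \<gamma> * 1 \<le> l * \<gamma> * (170 * A)" using A l \<gamma> by (intro mult_left_mono) auto
    then have "l * \<gamma> \<le> 1" using stepsize by (simp add: algebra_simps)
    then have "\<gamma>\<^sup>2 * (norm f)\<^sup>2 \<le> \<gamma> * ((norm f)\<^sup>2 / l)"
      using l \<gamma> mult_right_mono[of "l * \<gamma>" 1 "(norm f)\<^sup>2"] by (simp add: field_simps power2_eq_square)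
    also have "\<dots> \<le> \<gamma> * (f \<bullet> (x - p x) + \<delta>)"
      using p_coercive[OF x] \<gamma> by (intro mult_left_mono) (auto simp: f_def)
    finally show ?thesis by (simp add: algebra_simps)
  qed
  moreover have "step st b = (y, W + e, Z + increment x W e)"
    using assms by (simp add: step_def st e_def y_def f_def Let_def)
  then have "lyapunov u (step st b) = (norm (y - u))\<^sup>2 - 2 * ((xstar - u) \<bullet> W) - 2 * ((xstar - u) \<bullet> e)
      + (norm (W + e))\<^sup>2 + (infdist y S)\<^sup>2 - Z - increment x W e"
    by (simp add: lyapunov_def inner_add_right)
  moreover have "lyapunov u st = (norm (x - u))\<^sup>2 - 2 * ((xstar - u) \<bullet> W) + (norm W)\<^sup>2 + (infdist x S)\<^sup>2 - Z"
    by (simp add: lyapunov_def st)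
  moreover have "\<delta> * (1 + 2 * \<gamma>) = \<delta> + 2 * (\<gamma> * \<delta>)" "fst st = x"
    by (simp_all add: st algebra_simps)
  moreover have "increment x W e = 2 * ((x - u - \<gamma> *\<^sub>R f) \<bullet> e) - 2 * ((xstar - u) \<bullet> e) + 2 * (W \<bullet> e)
      + 2 * ((x - p x - \<gamma> *\<^sub>R f) \<bullet> e) + 3 * (norm e)\<^sup>2"
    unfolding increment_def direction_def f_def
    by (simp only: inner_add_left inner_diff_left) (simp add: algebra_simps)
  moreover have "(norm (W + e))\<^sup>2 = (norm W)\<^sup>2 + 2 * (W \<bullet> e) + (norm e)\<^sup>2"
    by (simp add: power2_norm_eq_inner inner_simps inner_commute)
  ultimately show ?thesis
    using sq[of u] sq[of "p x"] by (simp add: f_def[symmetric])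
qed

lemma lyapunov_path_xstar_le: "lyapunov xstar (path s k) \<le> 2 * R\<^sup>2 + real k * (\<delta> * (1 + 2 * \<gamma>))"
proof (induction k)
  case 0
  have "(norm (x0 - xstar))\<^sup>2 \<le> R\<^sup>2" using x0 by (intro power_mono) auto
  then show ?case
    by (simp add: lyapunov_def is_projection_imp_infdist[OF xstar_proj, symmetric])
next
  case (Suc k)
  show ?case
  proof (cases "active (path s k)")
    case True
    then have "xpath s k \<in> Q" by (auto simp: active_def split: prod.splits)
    then have "0 \<le> F (xpath s k) \<bullet> (xpath s k - xstar)"
      using monotone[of "xpath s k" xstar] R xstar_solution by simp
    then have "0 \<le> 2 * \<gamma> * (F (xpath s k) \<bullet> (xpath s k - xstar))" using \<gamma> by simp
    then show ?thesis
      using lyapunov_step[OF True, of xstar "\<lambda>i. s i k"] Suc by (simp add: algebra_simps)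
  next
    case False
    then have "path s (Suc k) = path s k" by (rule path_frozen) simp
    moreover have "0 \<le> \<delta> * (1 + 2 * \<gamma>)" using \<delta>(1) \<gamma> by simp
    ultimately show ?thesis using Suc by (simp add: distrib_right)
  qed
qed

lemma path_active:
  assumes "Zpath s n \<le> R\<^sup>2" "k \<le> n"
  shows "active (path s k)"
proof (rule active_mono)
  obtain x W Z where st: "path s n = (x, W, Z)" by (cases "path s n")
  \<comment> \<open>The \<open>4 * R\<^sup>2\<close> consists of \<open>2 * R\<^sup>2\<close> from
    the start, \<open>R\<^sup>2\<close> from the accumulated errors \<open>\<delta>\<close> and
    \<open>R\<^sup>2\<close> from \<open>Z\<close>.\<close>
  have "(norm (x - xstar))\<^sup>2 + (norm W)\<^sup>2 + (infdist x S)\<^sup>2 \<le> (2 * R)\<^sup>2"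
    using lyapunov_path_xstar_le[of s n] assms(1) \<delta> by (simp add: st lyapunov_def power_mult_distrib)
  then have "(norm (x - xstar))\<^sup>2 \<le> (2 * R)\<^sup>2" "(norm W)\<^sup>2 \<le> (2 * R)\<^sup>2"
    using zero_le_power2[of "norm (x - xstar)"] zero_le_power2[of "norm W"] zero_le_power2[of "infdist x S"]
    by linarith+
  then have "norm (x - xstar) \<le> 2 * R" "norm W \<le> 2 * R"
    using R by (auto intro: power2_le_imp_le)
  then show "active (path s n)"
    by (simp add: active_def st dist_norm norm_minus_commute)
qed (rule assms(2))

text \<open>Each active step pays for its own summand. The initial value is at most
  \<open>4 * R\<^sup>2 + R\<^sup>2\<close>, since \<open>x0\<close> is within \<open>2 * R\<close>
  of \<open>u\<close> and within \<open>R\<close> of \<open>S\<close>.\<close>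

lemma lyapunov_path_le:
  assumes "\<And>j. j < k \<Longrightarrow> active (path s j)" "u \<in> cball xstar R"
  shows "lyapunov u (path s k) + 2 * \<gamma> * (\<Sum>j<k. F (xpath s j) \<bullet> (xpath s j - u))
    \<le> 5 * R\<^sup>2 + real k * (\<delta> * (1 + 2 * \<gamma>))"
  using assms(1)
proof (induction k)
  case 0
  have "norm (x0 - u) \<le> norm (x0 - xstar) + norm (xstar - u)"
    by (rule order_trans[OF _ norm_triangle_ineq]) simp
  then have "norm (x0 - u) \<le> 2 * R" using x0 assms(2) by (simp add: dist_norm)
  then have "(norm (x0 - u))\<^sup>2 \<le> (2 * R)\<^sup>2" by (intro power_mono) auto
  moreover have "(norm (x0 - xstar))\<^sup>2 \<le> R\<^sup>2" using x0 by (intro power_mono) auto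
  ultimately show ?case
    by (simp add: lyapunov_def is_projection_imp_infdist[OF xstar_proj, symmetric] power_mult_distrib)
next
  case (Suc k)
  then have "lyapunov u (path s k) + 2 * \<gamma> * (\<Sum>j<k. F (xpath s j) \<bullet> (xpath s j - u))
    \<le> 5 * R\<^sup>2 + real k * (\<delta> * (1 + 2 * \<gamma>))" by simp
  moreover have "active (path s k)" using Suc.prems by simp
  ultimately show ?case
    using lyapunov_step[of "path s k" u "\<lambda>i. s i k"] by (simp add: algebra_simps)
qed

text \<open>Adding the noise to the exact step \<open>x - \<gamma> *\<^sub>R F x\<close> replaces
  \<open>F x\<close> by the clipped batch mean.\<close>

lemma path_eq_clipped_SGDA:
  assumes "\<And>j. j < k \<Longrightarrow> active (path s j)"
  shows "xpath s k = clipped_SGDA G \<gamma> (\<lambda>_. lam) (\<lambda>_. m) x0 s k"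
  using assms
proof (induction k)
  case (Suc k)
  then have "active (path s k)" "xpath s k = clipped_SGDA G \<gamma> (\<lambda>_. lam) (\<lambda>_. m) x0 s k" by auto
  then show ?case
    by (cases "path s k")
      (simp add: step_def Let_def noise_def batch_mean_def scaleR_diff_right)
qed simp

lemma gap_average_le:
  assumes Z: "Zpath s n \<le> R\<^sup>2" and K: "n = Suc K"
  shows "gap F xstar R (average_iterate (clipped_SGDA G \<gamma> (\<lambda>_. lam) (\<lambda>_. m) x0 s) K)
    \<le> 9 * R\<^sup>2 / (2 * \<gamma> * real n)"
proof -
  have act: "active (path s k)" if "k \<le> n" for k by (rule path_active[OF Z that])
  define a where "a = average_iterate (clipped_SGDA G \<gamma> (\<lambda>_. lam) (\<lambda>_. m) x0 s) K"
  have a: "a = (1 / real n) *\<^sub>R (\<Sum>j<n. xpath s j)"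
  proof -
    have "(\<Sum>j=0..K. clipped_SGDA G \<gamma> (\<lambda>_. lam) (\<lambda>_. m) x0 s j) = (\<Sum>j<n. xpath s j)"
      using act by (intro sum.cong) (auto simp: K path_eq_clipped_SGDA)
    then show ?thesis by (simp add: a_def average_iterate_def K)
  qed
  have "F u \<bullet> (a - u) \<le> 9 * R\<^sup>2 / (2 * \<gamma> * real n)" if u: "u \<in> cball xstar R" for u
  proof -
    have u': "u \<in> Q" using u R by simp
    obtain x W Z where st: "path s n = (x, W, Z)" by (cases "path s n")
    have "(norm (xstar - u))\<^sup>2 \<le> R\<^sup>2" using u by (intro power_mono) (auto simp: dist_norm)
    \<comment> \<open>Completing the square bounds the terms in \<open>W\<close> below by
      \<open>- (norm (xstar - u))\<^sup>2\<close>, hence by \<open>- R\<^sup>2\<close>; the other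
      \<open>- R\<^sup>2\<close> comes from \<open>Z\<close>.\<close>
    moreover have "0 \<le> (norm (W - (xstar - u)))\<^sup>2" by simp
    moreover have "(norm (W - (xstar - u)))\<^sup>2 = (norm W)\<^sup>2 - 2 * ((xstar - u) \<bullet> W) + (norm (xstar - u))\<^sup>2"
      by (simp add: power2_norm_eq_inner inner_simps inner_commute)
    moreover have "lyapunov u (path s n) =
        (norm (x - u))\<^sup>2 - 2 * ((xstar - u) \<bullet> W) + (norm W)\<^sup>2 + (infdist x S)\<^sup>2 - Z" "Z \<le> R\<^sup>2"
      using Z by (simp_all add: lyapunov_def st)
    ultimately have "- 2 * R\<^sup>2 \<le> lyapunov u (path s n)"
      using zero_le_power2[of "norm (x - u)"] zero_le_power2[of "infdist x S"] by linarith
    moreover have "lyapunov u (path s n) + 2 * \<gamma> * (\<Sum>j<n. F (xpath s j) \<bullet> (xpath s j - u)) \<le> 6 * R\<^sup>2"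
      using lyapunov_path_le[of n s u] act u \<delta> by simp
    moreover have "(\<Sum>j<n. F u \<bullet> (xpath s j - u)) \<le> (\<Sum>j<n. F (xpath s j) \<bullet> (xpath s j - u))"
    proof (intro sum_mono monotone u')
      fix j assume "j \<in> {..<n}"
      then have "active (path s j)" by (intro act) auto
      then show "xpath s j \<in> Q" by (auto simp: active_def split: prod.splits)
    qed
    then have *: "2 * \<gamma> * (\<Sum>j<n. F u \<bullet> (xpath s j - u)) \<le> 2 * \<gamma> * (\<Sum>j<n. F (xpath s j) \<bullet> (xpath s j - u))"
      using \<gamma> by (intro mult_left_mono) auto
    have "(\<Sum>j<n. F u \<bullet> (xpath s j - u)) = real n * (F u \<bullet> (a - u))"
      using n by (simp add: a inner_diff_right inner_sum_right sum_subtractf right_diff_distrib)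
    moreover note *[unfolded this]
    \<comment> \<open>The estimates give \<open>6 + 2 = 8\<close>; relaxing this to 9 leads to the
      constants \<open>765 = 170 * 9 / 2\<close> and \<open>810 = 180 * 9 / 2\<close>.\<close>
    ultimately have "2 * \<gamma> * (real n * (F u \<bullet> (a - u))) \<le> 9 * R\<^sup>2"
      using zero_le_power2[of R] by linarith
    then show ?thesis using \<gamma> n by (simp add: field_simps)
  qed
  then show ?thesis
    unfolding gap_def a_def[symmetric] using R by (intro cSUP_least) auto
qed

subsection \<open>The exponential moment\<close>

lemma G_compose_measurable [measurable]:
  assumes [measurable]: "s \<in> measurable N D" "X \<in> borel_measurable N"
  shows "(\<lambda>\<omega>. G (s \<omega>) (X \<omega>)) \<in> borel_measurable N"
  using measurable_compose[OF measurable_Pair[OF assms] G_measurable] by simp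

lemma F_measurable [measurable]: "F \<in> borel_measurable borel"
  by (rule mean_operator_measurable[OF D G_measurable])

lemma batch_mean_measurable:
  assumes b: "\<And>i. i \<in> {1..m} \<Longrightarrow> (\<lambda>\<omega>. b \<omega> i) \<in> measurable N D"
    and [measurable]: "X \<in> borel_measurable N"
  shows "(\<lambda>\<omega>. batch_mean (b \<omega>) (X \<omega>)) \<in> borel_measurable N"
  unfolding batch_mean_def
  by (intro borel_measurable_scaleR borel_measurable_sum borel_measurable_const G_compose_measurable b assms)

lemma step_measurable:
  assumes [measurable]: "st \<in> borel_measurable N"
    and b: "\<And>i. i \<in> {1..m} \<Longrightarrow> (\<lambda>\<omega>. b \<omega> i) \<in> measurable N D"
  shows "(\<lambda>\<omega>. step (st \<omega>) (b \<omega>)) \<in> borel_measurable N"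
proof -
  define X W Z where "X = (\<lambda>\<omega>. fst (st \<omega>))" and "W = (\<lambda>\<omega>. fst (snd (st \<omega>)))"
    and "Z = (\<lambda>\<omega>. snd (snd (st \<omega>)))"
  have [measurable]: "X \<in> borel_measurable N" "W \<in> borel_measurable N" "Z \<in> borel_measurable N"
    unfolding X_def W_def Z_def by measurable
  have [measurable]: "(\<lambda>\<omega>. batch_mean (b \<omega>) (X \<omega>)) \<in> borel_measurable N"
    by (rule batch_mean_measurable[OF b]) auto
  define e where "e = (\<lambda>\<omega>. noise (X \<omega>) (batch_mean (b \<omega>) (X \<omega>)))"
  have [measurable]: "e \<in> borel_measurable N"
    unfolding e_def noise_def by measurable
  have "(\<lambda>\<omega>. step (st \<omega>) (b \<omega>)) = (\<lambda>\<omega>. if dist xstar (X \<omega>) \<le> 2 * R \<and> norm (W \<omega>) \<le> 2 * R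
      then (X \<omega> - \<gamma> *\<^sub>R F (X \<omega>) + e \<omega>, W \<omega> + e \<omega>, Z \<omega> + increment (X \<omega>) (W \<omega>) (e \<omega>)) else st \<omega>)"
    by (auto simp: fun_eq_iff step_def active_def X_def W_def Z_def e_def Let_def split: prod.splits)
  also have "\<dots> \<in> borel_measurable N"
  proof -
    have [measurable]: "(\<lambda>\<omega>. direction (X \<omega>) (W \<omega>)) \<in> borel_measurable N"
      unfolding direction_def by measurable
    have [measurable]: "(\<lambda>\<omega>. increment (X \<omega>) (W \<omega>) (e \<omega>)) \<in> borel_measurable N"
      unfolding increment_def by measurable
    show ?thesis by measurable
  qed
  finally show ?thesis .
qed

lemma path_measurable:
  assumes "\<And>i j. i \<in> {1..m} \<Longrightarrow> j < k \<Longrightarrow> (\<lambda>\<omega>. s \<omega> i j) \<in> measurable N D"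
  shows "(\<lambda>\<omega>. path (s \<omega>) k) \<in> borel_measurable N"
  using assms by (induction k) (auto intro!: step_measurable)

text \<open>This allows a batch to be replaced by its restriction to \<open>{1..m}\<close>, the form
  in which it is a point of \<open>batch_measure\<close>.\<close>

lemma step_cong:
  assumes "\<And>i. i \<in> {1..m} \<Longrightarrow> b i = b' i"
  shows "step st b = step st b'"
proof -
  have "batch_mean b = batch_mean b'"
    unfolding batch_mean_def
    by (intro ext arg_cong[where f = "scaleR _"] sum.cong refl) (simp only: assms)
  then show ?thesis by (simp only: step_def)
qed

lemma path_cong:
  assumes "\<And>i j. i \<in> {1..m} \<Longrightarrow> j < k \<Longrightarrow> s i j = s' i j"
  shows "path s k = path s' k"
  using assms
proof (induction k)
  case (Suc k)
  then have "path s k = path s' k" by simp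
  then show ?case using Suc.prems by (auto intro: step_cong)
qed simp

section \<open>Moments of a single batch\<close>

abbreviation "batch_measure \<equiv> PiM {1..m} (\<lambda>_. D)"

lemma prob_space_batch: "prob_space batch_measure"
  by (intro prob_space_PiM D)

lemma batch_mean_batch_measurable [measurable]:
  "(\<lambda>b. batch_mean b x) \<in> borel_measurable batch_measure"
  by (rule batch_mean_measurable) (auto intro: measurable_component_singleton)

text \<open>Under the product measure the coordinates are independent with law \<open>D\<close>.
  One-sample integrals transfer through \<open>distr\<close>, and the sample mean lemma supplies the
  factor \<open>1 / m\<close>.\<close>

lemma
  assumes x: "x \<in> Q"
  shows batch_mean_integrable: "integrable batch_measure (\<lambda>b. batch_mean b x)"
    and batch_mean_integral: "(\<integral>b. batch_mean b x \<partial>batch_measure) = F x"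
    and batch_mean_var_integrable: "integrable batch_measure (\<lambda>b. (norm (batch_mean b x - F x))\<^sup>2)"
    and batch_mean_var_le: "(\<integral>b. (norm (batch_mean b x - F x))\<^sup>2 \<partial>batch_measure) \<le> \<sigma>\<^sup>2 / real m"
proof -
  note [simp del] = One_nat_def
  interpret P: prob_space batch_measure by (rule prob_space_batch)
  have comp [measurable]: "(\<lambda>b. b i) \<in> measurable batch_measure D" if "i \<in> {1..m}" for i
    using that by (rule measurable_component_singleton)
  have dist: "distr batch_measure D (\<lambda>b. b i) = D" if "i \<in> {1..m}" for i
    by (rule distr_PiM_component[OF _ that]) (rule D)
  have "P.indep_vars (\<lambda>_. D) (\<lambda>i b. b i) {1..m}"
  proof (subst P.indep_vars_iff_distr_eq_PiM')
    show "distr batch_measure batch_measure (\<lambda>b. \<lambda>i\<in>{1..m}. b i) = (\<Pi>\<^sub>M i\<in>{1..m}. distr batch_measure D (\<lambda>b. b i))"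
    proof -
      have "distr batch_measure batch_measure (\<lambda>b. \<lambda>i\<in>{1..m}. b i) = distr batch_measure batch_measure (\<lambda>b. b)"
        by (rule distr_cong) (auto simp: space_PiM PiE_restrict)
      also have "\<dots> = batch_measure" by (simp add: distr_id)
      also have "\<dots> = (\<Pi>\<^sub>M i\<in>{1..m}. distr batch_measure D (\<lambda>b. b i))"
        by (rule PiM_cong[OF refl]) (rule dist[symmetric])
      finally show ?thesis .
    qed
  qed (use m comp in auto)
  then have ind: "P.indep_vars (\<lambda>_. borel) (\<lambda>i b. G (b i) x) {1..m}"
    by (rule P.indep_vars_compose2) simp
  have int: "integrable batch_measure (\<lambda>b. G (b i) x)" if "i \<in> {1..m}" for i
    using integrable_distr[OF comp[OF that], of "\<lambda>s. G s x"] G_integrable by (simp add: dist[OF that])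
  have mean: "(\<integral>b. G (b i) x \<partial>batch_measure) = F x" if "i \<in> {1..m}" for i
    using integral_distr[OF comp[OF that], of "\<lambda>s. G s x"] by (simp add: dist[OF that] mean_operator_def)
  have int2: "integrable batch_measure (\<lambda>b. (norm (G (b i) x - F x))\<^sup>2)" if "i \<in> {1..m}" for i
    using integrable_distr[OF comp[OF that], of "\<lambda>s. (norm (G s x - F x))\<^sup>2"] var_integrable[OF x]
    by (simp add: dist[OF that])
  have var: "(\<integral>b. (norm (G (b i) x - F x))\<^sup>2 \<partial>batch_measure) \<le> \<sigma>\<^sup>2" if "i \<in> {1..m}" for i
    using integral_distr[OF comp[OF that], of "\<lambda>s. (norm (G s x - F x))\<^sup>2"] var_le[OF x]
    by (simp add: dist[OF that])
  show "integrable batch_measure (\<lambda>b. batch_mean b x)"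
    unfolding batch_mean_def using int by (intro integrable_scaleR_right Bochner_Integration.integrable_sum) auto
  show "(\<integral>b. batch_mean b x \<partial>batch_measure) = F x"
    unfolding batch_mean_def using int m
    by (simp add: Bochner_Integration.integral_sum mean sum_constant_scaleR del: sum_constant)
  show "integrable batch_measure (\<lambda>b. (norm (batch_mean b x - F x))\<^sup>2)"
    using P.integrable_sample_mean_diff_sq[OF _ _ ind int mean int2 var] m
    by (simp add: batch_mean_def)
  show "(\<integral>b. (norm (batch_mean b x - F x))\<^sup>2 \<partial>batch_measure) \<le> \<sigma>\<^sup>2 / real m"
    using P.expectation_sample_mean_diff_sq_le[OF _ _ ind int mean int2 var] m
    by (simp add: batch_mean_def)
qed

section \<open>The exponential moment of a single step\<close>

lemma norm_direction_le:
  assumes "x \<in> Q" "norm W \<le> 2 * R"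
  shows "norm (direction x W) \<le> 8 * R"
proof -
  have x: "norm (x - xstar) \<le> 2 * R" using assms(1) by (simp add: dist_norm norm_minus_commute)
  have "R / (85 * A) \<le> R / 85" using R A by (simp add: field_simps)
  then have f: "norm (\<gamma> *\<^sub>R F x) \<le> R / 85" using \<gamma>_norm_F_le[OF assms(1)] \<gamma> by simp
  have "\<delta> \<le> R\<^sup>2"
  proof -
    have "1 * (\<delta> * 1) \<le> real n * (\<delta> * (1 + 2 * \<gamma>))"
      using n \<delta>(1) \<gamma> by (intro mult_mono) auto
    then show ?thesis using \<delta>(2) by simp
  qed
  moreover have "infdist x S \<le> 2 * R"
    using infdist_le[OF xstar_solution(1), of x] x by (simp add: dist_norm)
  then have "(infdist x S)\<^sup>2 \<le> (2 * R)\<^sup>2" by (intro power_mono infdist_nonneg)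
  ultimately have "(norm (x - p x))\<^sup>2 \<le> 5 * R\<^sup>2"
    using p_near[OF assms(1)] by (simp add: power_mult_distrib)
  also have "\<dots> \<le> (3 * R)\<^sup>2" by (simp add: power_mult_distrib)
  finally have "(norm (x - p x))\<^sup>2 \<le> (3 * R)\<^sup>2" .
  then have px: "norm (x - p x) \<le> 3 * R" using R by (auto intro: power2_le_imp_le)
  have "norm (direction x W) \<le> norm (x - xstar - \<gamma> *\<^sub>R F x) + norm W + norm (x - p x - \<gamma> *\<^sub>R F x)"
    unfolding direction_def by (intro norm_triangle_le add_mono order_refl norm_triangle_ineq)
  \<comment> \<open>The contributions are \<open>2 * R\<close>, \<open>2 * R\<close> and
    \<open>3 * R\<close>, plus \<open>R / 85\<close> twice from the steps.\<close>
  also have "\<dots> \<le> 8 * R"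
    using norm_triangle_ineq4[of "x - xstar" "\<gamma> *\<^sub>R F x"] norm_triangle_ineq4[of "x - p x" "\<gamma> *\<^sub>R F x"]
      x f px assms(2) R by linarith
  finally show ?thesis .
qed

text \<open>Chosen so that \<open>rate * R\<^sup>2 = 3 * A / 2\<close>: the Chernoff bound at level
  \<open>R\<^sup>2\<close> then loses \<open>A / 2\<close> to the exponential moment and keeps
  \<open>exp (- A)\<close>.\<close>

definition rate :: real where "rate = 3 * A / (2 * R\<^sup>2)"

lemma rate_pos: "0 < rate"
  using A R by (simp add: rate_def)

text \<open>The clipped noise has size at most \<open>R / (30 * A)\<close>, second moment at most
  \<open>v\<close> and bias at most \<open>51 * A * v / R\<close>; these feed the one-step moment
  bound. The target is the share \<open>1 / n\<close> of the total exponent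
  \<open>A / 2\<close>.\<close>

lemma exp_increment_le:
  assumes x: "x \<in> Q" and W: "norm W \<le> 2 * R"
  shows "(\<integral>\<^sup>+b. ennreal (exp (rate * increment x W (noise x (batch_mean b x)))) \<partial>batch_measure)
    \<le> ennreal (exp (A / (2 * real n)))"
proof -
  note [simp del] = One_nat_def
  interpret P: prob_space batch_measure by (rule prob_space_batch)
  define e where "e = (\<lambda>b. noise x (batch_mean b x))"
  \<comment> \<open>The margin between \<open>lam\<close> and the bound on
    \<open>norm (F x)\<close>: \<open>1 / 60 - 1 / 85 = 1 / 204\<close>.\<close>
  define c where "c = R / (204 * \<gamma> * A)"
  define v where "v = \<gamma>\<^sup>2 * (\<sigma>\<^sup>2 / real m)"
  have lam_pos: "0 < lam" and c: "0 < c" using lam R \<gamma> A by (simp_all add: c_def)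
  have [measurable]: "e \<in> borel_measurable batch_measure" unfolding e_def noise_def by measurable
  have "norm (F x) \<le> R / (85 * A) / \<gamma>" using \<gamma>_norm_F_le[OF x] \<gamma>
    by (simp only: pos_le_divide_eq mult.commute)
  also have "\<dots> + c = lam" using \<gamma> A by (simp add: c_def lam field_simps)
  finally have Fc: "norm (F x) + c \<le> lam" by simp
  then have F_lam: "norm (F x) \<le> lam" using c by simp
  have B: "norm (e b) \<le> R / (30 * A)" for b
  proof -
    have "norm (F x - clip (batch_mean b x) lam) \<le> lam + lam"
      using F_lam norm_clip_le[of lam "batch_mean b x"] lam_pos
      by (intro order_trans[OF norm_triangle_ineq4] add_mono) auto
    then have "norm (e b) \<le> \<gamma> * (lam + lam)"
      using \<gamma> by (simp add: e_def noise_def)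
    also have "\<dots> = R / (30 * A)" using \<gamma> A by (simp add: lam field_simps)
    finally show ?thesis .
  qed
  have v_le: "P.expectation (\<lambda>b. (norm (e b))\<^sup>2) \<le> v"
  proof -
    have "P.expectation (\<lambda>b. (norm (e b))\<^sup>2) \<le> P.expectation (\<lambda>b. \<gamma>\<^sup>2 * (norm (batch_mean b x - F x))\<^sup>2)"
    proof (rule integral_mono)
      show "integrable batch_measure (\<lambda>b. (norm (e b))\<^sup>2)"
        by (rule P.integrable_const_bound[of _ "(R / (30 * A))\<^sup>2"]) (use B in \<open>auto intro!: power_mono\<close>)
      show "integrable batch_measure (\<lambda>b. \<gamma>\<^sup>2 * (norm (batch_mean b x - F x))\<^sup>2)"
        using batch_mean_var_integrable[OF x] by simp
      fix b
      have "(norm (clip (batch_mean b x) lam - F x))\<^sup>2 \<le> (norm (batch_mean b x - F x))\<^sup>2"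
        by (intro power_mono norm_clip_diff_le lam_pos F_lam) auto
      then show "(norm (e b))\<^sup>2 \<le> \<gamma>\<^sup>2 * (norm (batch_mean b x - F x))\<^sup>2"
        by (simp add: e_def noise_def power_mult_distrib norm_minus_commute mult_left_mono)
    qed
    also have "\<dots> \<le> v"
      using mult_left_mono[OF batch_mean_var_le[OF x], of "\<gamma>\<^sup>2"] by (simp add: v_def)
    finally show ?thesis .
  qed
  \<comment> \<open>The batch mean is unbiased, so only the clipped-off part contributes, and the
    margin \<open>c\<close> bounds it by a square. The constant is
    \<open>51 = 204 / 4\<close>.\<close>
  have bias: "norm (P.expectation e) \<le> 51 * A * v / R"
  proof -
    have int_c: "integrable batch_measure (\<lambda>b. clip (batch_mean b x) lam)"
      by (rule P.integrable_const_bound[of _ lam]) (use lam_pos in \<open>auto intro!: norm_clip_le\<close>)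
    have "P.expectation e = \<gamma> *\<^sub>R P.expectation (\<lambda>b. batch_mean b x - clip (batch_mean b x) lam)"
      unfolding e_def noise_def using int_c batch_mean_integrable[OF x]
      by (simp add: batch_mean_integral[OF x] P.prob_space)
    then have "norm (P.expectation e) = \<gamma> * norm (P.expectation (\<lambda>b. batch_mean b x - clip (batch_mean b x) lam))"
      using \<gamma> by simp
    also have "\<dots> \<le> \<gamma> * P.expectation (\<lambda>b. norm (batch_mean b x - clip (batch_mean b x) lam))"
      using \<gamma> by (intro mult_left_mono integral_norm_bound) auto
    also have "\<dots> \<le> \<gamma> * P.expectation (\<lambda>b. (norm (batch_mean b x - F x))\<^sup>2 / (4 * c))"
    proof (intro mult_left_mono integral_mono)
      fix b
      show "norm (batch_mean b x - clip (batch_mean b x) lam) \<le> (norm (batch_mean b x - F x))\<^sup>2 / (4 * c)"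
        using norm_clip_self_diff_le[OF c Fc, of "batch_mean b x"] by (simp add: norm_minus_commute)
    qed (use int_c batch_mean_integrable[OF x] batch_mean_var_integrable[OF x] \<gamma> in auto)
    also have "\<dots> = \<gamma> / (4 * c) * P.expectation (\<lambda>b. (norm (batch_mean b x - F x))\<^sup>2)" by simp
    also have "\<dots> \<le> \<gamma> / (4 * c) * (\<sigma>\<^sup>2 / real m)"
      using batch_mean_var_le[OF x] c \<gamma> by (intro mult_left_mono) auto
    also have "\<dots> = 51 * A * v / R"
      using \<gamma> A R by (simp add: c_def v_def field_simps power2_eq_square)
    finally show ?thesis .
  qed
  have t: "rate * (2 * (8 * R) * (R / (30 * A)) + 3 * (R / (30 * A))\<^sup>2) \<le> 1"
  proof -
    have "rate * (2 * (8 * R) * (R / (30 * A)) + 3 * (R / (30 * A))\<^sup>2) = 4 / 5 + 1 / (200 * A)"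
      using A R by (simp add: rate_def field_simps power2_eq_square)
    also have "\<dots> \<le> 1" using A by (simp add: field_simps)
    finally show ?thesis .
  qed
  have v0: "0 \<le> v" by (simp add: v_def)
  have "real n * v * A * 97200 \<le> R\<^sup>2"
    using batch m by (simp add: v_def field_simps)
  then have nv: "v * A\<^sup>2 / R\<^sup>2 \<le> A / (97200 * real n)"
    using n R A mult_right_mono[of "real n * v * A * 97200" "R\<^sup>2" A] by (simp add: field_simps power2_eq_square)
  \<comment> \<open>In units of \<open>v * A\<^sup>2 / R\<^sup>2\<close> the bias contributes
    \<open>1224\<close>, the mean of the squared noise at most 5, and the quadratic term at most
    \<open>(17 * 3 / 2)\<^sup>2 = 2601 / 4\<close>. By \<open>nv\<close> the total is far below
    \<open>A / (2 * n)\<close>.\<close>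
  have "rate * (2 * (8 * R) * (51 * A * v / R) + 3 * v) + rate\<^sup>2 * (2 * (8 * R) + 3 * (R / (30 * A)))\<^sup>2 * v
      \<le> 1900 * (v * A\<^sup>2 / R\<^sup>2)"
  proof -
    have "rate * (2 * (8 * R) * (51 * A * v / R) + 3 * v) = (1224 + 9 / (2 * A)) * (v * A\<^sup>2 / R\<^sup>2)"
      using A R by (simp add: rate_def field_simps power2_eq_square)
    also have "\<dots> \<le> 1229 * (v * A\<^sup>2 / R\<^sup>2)"
      using A v0 by (intro mult_right_mono) (auto simp: field_simps)
    finally have 1: "rate * (2 * (8 * R) * (51 * A * v / R) + 3 * v) \<le> 1229 * (v * A\<^sup>2 / R\<^sup>2)" .
    have "2 * (8 * R) + 3 * (R / (30 * A)) \<le> 17 * R" using A R by (simp add: field_simps)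
    then have "(2 * (8 * R) + 3 * (R / (30 * A)))\<^sup>2 \<le> (17 * R)\<^sup>2"
      using A R by (intro power_mono) auto
    then have "rate\<^sup>2 * (2 * (8 * R) + 3 * (R / (30 * A)))\<^sup>2 * v \<le> rate\<^sup>2 * (17 * R)\<^sup>2 * v"
      using v0 by (intro mult_right_mono mult_left_mono) auto
    also have "\<dots> = 2601 / 4 * (v * A\<^sup>2 / R\<^sup>2)"
      using A R by (simp add: rate_def field_simps power2_eq_square)
    finally have 2: "rate\<^sup>2 * (2 * (8 * R) + 3 * (R / (30 * A)))\<^sup>2 * v \<le> 2601 / 4 * (v * A\<^sup>2 / R\<^sup>2)" .
    have *: "1229 * q + 2601 / 4 * q \<le> 1900 * q" if "0 \<le> q" for q :: real using that by simp
    have "1229 * (v * A\<^sup>2 / R\<^sup>2) + 2601 / 4 * (v * A\<^sup>2 / R\<^sup>2) \<le> 1900 * (v * A\<^sup>2 / R\<^sup>2)"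
      by (rule *) (use v0 in simp)
    with add_mono[OF 1 2] show ?thesis by (rule order_trans)
  qed
  also have "\<dots> \<le> 1900 * (A / (97200 * real n))" using nv by simp
  also have "\<dots> \<le> A / (2 * real n)" using A n by (simp add: field_simps)
  finally have "rate * (2 * (8 * R) * (51 * A * v / R) + 3 * v)
      + rate\<^sup>2 * (2 * (8 * R) + 3 * (R / (30 * A)))\<^sup>2 * v \<le> A / (2 * real n)" .
  then have le: "ennreal (exp (rate * (2 * (8 * R) * (51 * A * v / R) + 3 * v)
      + rate\<^sup>2 * (2 * (8 * R) + 3 * (R / (30 * A)))\<^sup>2 * v)) \<le> ennreal (exp (A / (2 * real n)))"
    by (intro ennreal_leI) simp
  have B0: "0 \<le> R / (30 * A)" and t0: "0 \<le> rate" using A R rate_pos by simp_all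
  have e: "noise x (batch_mean b x) = e b" for b by (simp add: e_def)
  show ?thesis
    unfolding increment_def e
    by (rule order_trans[OF P.nn_integral_exp_inner_plus_sq_le[OF _ B B0 v_le bias norm_direction_le[OF x W] t0 t] le])
      measurable
qed

text \<open>The past state is fixed here and only the fresh batch is integrated. A frozen state
  contributes the factor 1, so the bound is uniform in \<open>st\<close>.\<close>

lemma exp_Zpath_step_le:
  "(\<integral>\<^sup>+b. ennreal (exp (rate * snd (snd (step st b)))) \<partial>batch_measure)
    \<le> ennreal (exp (A / (2 * real n))) * ennreal (exp (rate * snd (snd st)))"
proof -
  note [simp del] = One_nat_def
  interpret P: prob_space batch_measure by (rule prob_space_batch)
  obtain x W Z where st: "st = (x, W, Z)" by (cases st)
  show ?thesis
  proof (cases "active st")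
    case True
    then have x: "x \<in> Q" "norm W \<le> 2 * R" by (auto simp: active_def st)
    have "(\<integral>\<^sup>+b. ennreal (exp (rate * snd (snd (step st b)))) \<partial>batch_measure)
      = (\<integral>\<^sup>+b. ennreal (exp (rate * Z)) * ennreal (exp (rate * increment x W (noise x (batch_mean b x)))) \<partial>batch_measure)"
      using True
      by (intro nn_integral_cong) (simp add: step_def st Let_def distrib_left exp_add ennreal_mult)
    also have "\<dots> = ennreal (exp (rate * Z)) * (\<integral>\<^sup>+b. ennreal (exp (rate * increment x W (noise x (batch_mean b x)))) \<partial>batch_measure)"
      unfolding increment_def noise_def by (rule nn_integral_cmult) measurable
    also have "\<dots> \<le> ennreal (exp (rate * Z)) * ennreal (exp (A / (2 * real n)))"
      by (intro mult_left_mono exp_increment_le x) simp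
    finally show ?thesis by (simp add: st mult.commute)
  next
    case False
    have "ennreal 1 * ennreal (exp (rate * Z)) \<le> ennreal (exp (A / (2 * real n))) * ennreal (exp (rate * Z))"
      using A by (intro mult_right_mono ennreal_leI) auto
    moreover have "step st b = st" for b using False by (simp add: step_def st)
    ultimately show ?thesis by (simp add: P.emeasure_space_1 st)
  qed
qed

section \<open>Independence of the batches and the tail bound\<close>

abbreviation samples :: "'w \<Rightarrow> nat \<Rightarrow> nat \<Rightarrow> 's" where
  "samples \<omega> \<equiv> \<lambda>i k. \<xi> i k \<omega>"

lemma \<xi>_measurable [measurable]: "\<xi> i k \<in> measurable M D"
  using prob_space.indep_vars_def[THEN iffD1, OF M indep] by force

lemma path_samples_measurable [measurable]: "(\<lambda>\<omega>. path (samples \<omega>) k) \<in> borel_measurable M"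
  by (rule path_measurable) simp

text \<open>The whole family has a product law, and column \<open>k\<close> is its image under the
  injective reindexing \<open>i \<mapsto> (i, k)\<close>.\<close>

lemma batch_distr: "distr M batch_measure (\<lambda>\<omega>. \<lambda>i\<in>{1..m}. \<xi> i k \<omega>) = batch_measure"
proof -
  interpret M: prob_space M by (rule M)
  let ?U = "PiM UNIV (\<lambda>_. D) :: (nat \<times> nat \<Rightarrow> 's) measure"
  have "distr M ?U (\<lambda>\<omega>. \<lambda>j\<in>UNIV. (case j of (i, k) \<Rightarrow> \<xi> i k) \<omega>) = (\<Pi>\<^sub>M j\<in>UNIV. distr M D (case j of (i, k) \<Rightarrow> \<xi> i k))"
    using indep by (subst (asm) M.indep_vars_iff_distr_eq_PiM) (auto split: prod.splits)
  also have "\<dots> = ?U"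
    by (intro PiM_cong refl) (simp add: distr split: prod.splits)
  finally have U: "distr M ?U (\<lambda>\<omega>. \<lambda>j\<in>UNIV. (case j of (i, k) \<Rightarrow> \<xi> i k) \<omega>) = ?U" .
  have "batch_measure = distr ?U batch_measure (\<lambda>g. \<lambda>i\<in>{1..m}. g (i, k))"
    by (rule distr_PiM_reindex[symmetric]) (auto simp: inj_on_def D)
  also have "\<dots> = distr (distr M ?U (\<lambda>\<omega>. \<lambda>j\<in>UNIV. (case j of (i, k) \<Rightarrow> \<xi> i k) \<omega>)) batch_measure (\<lambda>g. \<lambda>i\<in>{1..m}. g (i, k))"
    by (simp only: U)
  also have "\<dots> = distr M batch_measure (\<lambda>\<omega>. \<lambda>i\<in>{1..m}. \<xi> i k \<omega>)"
    by (subst distr_distr) (auto simp: comp_def split: prod.splits intro!: measurable_restrict measurable_component_singleton)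
  finally show ?thesis by simp
qed

text \<open>A Fubini substitute for conditional expectations. The state at time \<open>k\<close> is
  a function of the samples indexed by \<open>I\<close>, the current batch of those indexed by
  \<open>J\<close>; these index sets are disjoint, so the two sample vectors are
  independent.\<close>

lemma nn_integral_path_batch:
  assumes f: "f \<in> borel_measurable (borel \<Otimes>\<^sub>M batch_measure)"
  shows "(\<integral>\<^sup>+\<omega>. f (path (samples \<omega>) k, \<lambda>i\<in>{1..m}. \<xi> i k \<omega>) \<partial>M)
    = (\<integral>\<^sup>+\<omega>. (\<integral>\<^sup>+b. f (path (samples \<omega>) k, b) \<partial>batch_measure) \<partial>M)"
proof -
  interpret M: prob_space M by (rule M)
  interpret P: prob_space batch_measure by (rule prob_space_batch)
  define I J where "I = {1..m} \<times> {..<k}" and "J = {1..m} \<times> {k}"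
  define past now where "past = (\<lambda>\<omega>. restrict (\<lambda>j. (case j of (i, k) \<Rightarrow> \<xi> i k) \<omega>) I)"
    and "now = (\<lambda>\<omega>. restrict (\<lambda>j. (case j of (i, k) \<Rightarrow> \<xi> i k) \<omega>) J)"
  define g where "g = (\<lambda>s. path (\<lambda>i j. s (i, j)) k)"
  define h where "h = (\<lambda>s :: nat \<times> nat \<Rightarrow> 's. \<lambda>i\<in>{1..m}. s (i, k))"
  let ?I = "PiM I (\<lambda>_. D)" and ?J = "PiM J (\<lambda>_. D)"
  have ind: "M.indep_var ?I past ?J now"
    unfolding past_def now_def by (rule M.indep_var_restrict[OF indep]) (auto simp: I_def J_def)
  have past [measurable]: "past \<in> measurable M ?I" and now [measurable]: "now \<in> measurable M ?J"
    using M.indep_var_rv1[OF ind] M.indep_var_rv2[OF ind] by simp_all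
  have g [measurable]: "g \<in> measurable ?I borel"
    unfolding g_def by (rule path_measurable) (auto simp: I_def intro: measurable_component_singleton)
  have h [measurable]: "h \<in> measurable ?J batch_measure"
    unfolding h_def by (rule measurable_restrict) (auto simp: J_def intro: measurable_component_singleton)
  have g_past: "g (past \<omega>) = path (samples \<omega>) k" for \<omega>
    unfolding g_def past_def by (rule path_cong) (auto simp: I_def)
  have h_now: "h (now \<omega>) = (\<lambda>i\<in>{1..m}. \<xi> i k \<omega>)" for \<omega>
    by (auto simp: h_def now_def J_def fun_eq_iff)
  interpret J: prob_space "distr M ?J now" by (rule M.prob_space_distr[OF now])
  have int_distr: "(\<integral>\<^sup>+z. u z \<partial>distr M N T) = (\<integral>\<^sup>+\<omega>. u (T \<omega>) \<partial>M)"
    if "T \<in> measurable M N" "u \<in> borel_measurable N" for T N and u :: "_ \<Rightarrow> ennreal"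
    using that by (simp add: nn_integral_distr)
  have fgh: "(\<lambda>z. f (g (fst z), h (snd z))) \<in> borel_measurable (?I \<Otimes>\<^sub>M ?J)"
    by (rule measurable_compose[OF _ f]) measurable
  have fst': "(\<lambda>b. f (st, b)) \<in> borel_measurable batch_measure" for st
    by (rule measurable_compose[OF _ f]) measurable
  have "(\<integral>\<^sup>+\<omega>. f (path (samples \<omega>) k, \<lambda>i\<in>{1..m}. \<xi> i k \<omega>) \<partial>M)
      = (\<integral>\<^sup>+\<omega>. (\<lambda>z. f (g (fst z), h (snd z))) (past \<omega>, now \<omega>) \<partial>M)"
    by (simp only: g_past h_now fst_conv snd_conv)
  also have "\<dots> = (\<integral>\<^sup>+z. f (g (fst z), h (snd z)) \<partial>distr M (?I \<Otimes>\<^sub>M ?J) (\<lambda>\<omega>. (past \<omega>, now \<omega>)))"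
    by (rule int_distr[symmetric, OF _ fgh]) measurable
  also have "distr M (?I \<Otimes>\<^sub>M ?J) (\<lambda>\<omega>. (past \<omega>, now \<omega>)) = distr M ?I past \<Otimes>\<^sub>M distr M ?J now"
    using ind unfolding M.indep_var_distribution_eq by simp
  also have "(\<integral>\<^sup>+z. f (g (fst z), h (snd z)) \<partial>(distr M ?I past \<Otimes>\<^sub>M distr M ?J now))
      = (\<integral>\<^sup>+s. \<integral>\<^sup>+t. f (g s, h t) \<partial>distr M ?J now \<partial>distr M ?I past)"
    using J.nn_integral_fst[of "\<lambda>z. f (g (fst z), h (snd z))" "distr M ?I past"] fgh
    by (simp cong: measurable_cong_sets sets_pair_measure_cong)
  also have "\<dots> = (\<integral>\<^sup>+s. \<integral>\<^sup>+b. f (g s, b) \<partial>batch_measure \<partial>distr M ?I past)"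
  proof (rule nn_integral_cong)
    fix s
    have "(\<integral>\<^sup>+t. f (g s, h t) \<partial>distr M ?J now) = (\<integral>\<^sup>+\<omega>. f (g s, h (now \<omega>)) \<partial>M)"
      by (rule int_distr[OF now]) (rule measurable_compose[OF h fst'])
    also have "\<dots> = (\<integral>\<^sup>+b. f (g s, b) \<partial>distr M batch_measure (\<lambda>\<omega>. h (now \<omega>)))"
      by (rule int_distr[symmetric, OF measurable_compose[OF now h] fst'])
    also have "distr M batch_measure (\<lambda>\<omega>. h (now \<omega>)) = batch_measure"
      unfolding h_now by (rule batch_distr)
    finally show "(\<integral>\<^sup>+t. f (g s, h t) \<partial>distr M ?J now) = (\<integral>\<^sup>+b. f (g s, b) \<partial>batch_measure)" .
  qed
  also have "\<dots> = (\<integral>\<^sup>+\<omega>. (\<integral>\<^sup>+b. f (g (past \<omega>), b) \<partial>batch_measure) \<partial>M)"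
    by (rule int_distr[OF past])
      (rule measurable_compose[OF g P.borel_measurable_nn_integral_fst[OF f]])
  finally show ?thesis by (simp only: g_past)
qed

text \<open>A supermartingale argument by induction: integrating out the newest batch costs one
  factor \<open>exp (A / (2 * n))\<close>, whatever the past.\<close>

lemma exp_Zpath_le:
  "(\<integral>\<^sup>+\<omega>. ennreal (exp (rate * Zpath (samples \<omega>) k)) \<partial>M) \<le> ennreal (exp (real k * (A / (2 * real n))))"
proof (induction k)
  case 0
  interpret M: prob_space M by (rule M)
  show ?case by (simp add: M.emeasure_space_1)
next
  case (Suc k)
  define f where "f = (\<lambda>(st, b). ennreal (exp (rate * snd (snd (step st b)))))"
  have "(\<lambda>z. step (fst z) (snd z)) \<in> borel_measurable (borel \<Otimes>\<^sub>M batch_measure)"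
    by (rule step_measurable)
      (auto intro: measurable_compose[OF measurable_snd measurable_component_singleton])
  then have f: "f \<in> borel_measurable (borel \<Otimes>\<^sub>M batch_measure)"
    unfolding f_def case_prod_beta by measurable
  have "path (samples \<omega>) (Suc k) = step (path (samples \<omega>) k) (\<lambda>i\<in>{1..m}. \<xi> i k \<omega>)" for \<omega>
    by (auto intro: step_cong)
  then have "(\<integral>\<^sup>+\<omega>. ennreal (exp (rate * Zpath (samples \<omega>) (Suc k))) \<partial>M)
      = (\<integral>\<^sup>+\<omega>. f (path (samples \<omega>) k, \<lambda>i\<in>{1..m}. \<xi> i k \<omega>) \<partial>M)"
    by (simp only: f_def prod.case)
  also have "\<dots> = (\<integral>\<^sup>+\<omega>. (\<integral>\<^sup>+b. f (path (samples \<omega>) k, b) \<partial>batch_measure) \<partial>M)"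
    by (rule nn_integral_path_batch[OF f])
  also have "\<dots> \<le> (\<integral>\<^sup>+\<omega>. ennreal (exp (A / (2 * real n))) * ennreal (exp (rate * Zpath (samples \<omega>) k)) \<partial>M)"
    unfolding f_def prod.case by (intro nn_integral_mono exp_Zpath_step_le)
  also have "\<dots> = ennreal (exp (A / (2 * real n))) * (\<integral>\<^sup>+\<omega>. ennreal (exp (rate * Zpath (samples \<omega>) k)) \<partial>M)"
    by (rule nn_integral_cmult) measurable
  also have "\<dots> \<le> ennreal (exp (A / (2 * real n))) * ennreal (exp (real k * (A / (2 * real n))))"
    by (intro mult_left_mono Suc) simp
  also have "\<dots> = ennreal (exp (real (Suc k) * (A / (2 * real n))))"
    by (simp only: ennreal_mult[symmetric] exp_ge_zero exp_add[symmetric] of_nat_Suc distrib_right mult_1)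
  finally show ?case .
qed

lemma prob_Zpath_le:
  "measure M {\<omega> \<in> space M. Zpath (samples \<omega>) n \<le> R\<^sup>2} \<ge> 1 - exp (- A)"
proof -
  interpret M: prob_space M by (rule M)
  have [measurable]: "(\<lambda>\<omega>. Zpath (samples \<omega>) n) \<in> borel_measurable M" by measurable
  have "emeasure M {\<omega> \<in> space M. Zpath (samples \<omega>) n \<ge> R\<^sup>2}
      \<le> ennreal (exp (- rate * R\<^sup>2)) * (\<integral>\<^sup>+\<omega>. ennreal (exp (rate * Zpath (samples \<omega>) n)) * indicator (space M) \<omega> \<partial>M)"
    by (rule Chernoff_ineq_nn_integral_ge[OF rate_pos]) auto
  also have "\<dots> = ennreal (exp (- rate * R\<^sup>2)) * (\<integral>\<^sup>+\<omega>. ennreal (exp (rate * Zpath (samples \<omega>) n)) \<partial>M)"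
    by (intro arg_cong2[where f = "(*)"] nn_integral_cong refl) simp
  also have "\<dots> \<le> ennreal (exp (- rate * R\<^sup>2)) * ennreal (exp (real n * (A / (2 * real n))))"
    by (intro mult_left_mono exp_Zpath_le) simp
  also have "\<dots> = ennreal (exp (- A))"
  proof -
    have "- rate * R\<^sup>2 + real n * (A / (2 * real n)) = - A"
      using R n by (simp add: rate_def field_simps)
    then show ?thesis by (simp add: ennreal_mult[symmetric] exp_add[symmetric])
  qed
  finally have "measure M {\<omega> \<in> space M. Zpath (samples \<omega>) n \<ge> R\<^sup>2} \<le> exp (- A)"
    by (simp add: M.emeasure_eq_measure)
  then have "1 - exp (- A) \<le> 1 - measure M {\<omega> \<in> space M. Zpath (samples \<omega>) n \<ge> R\<^sup>2}" by simp
  also have "\<dots> = measure M (space M - {\<omega> \<in> space M. Zpath (samples \<omega>) n \<ge> R\<^sup>2})"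
    by (rule M.prob_compl[symmetric]) measurable
  also have "\<dots> \<le> measure M {\<omega> \<in> space M. Zpath (samples \<omega>) n \<le> R\<^sup>2}"
    by (rule M.finite_measure_mono) auto
  finally show ?thesis .
qed

section \<open>From the event on \<open>Z\<close> to the gap\<close>

lemma clipped_SGDA_measurable:
  "(\<lambda>\<omega>. clipped_SGDA G \<gamma> (\<lambda>_. lam) (\<lambda>_. m) x0 (samples \<omega>) k) \<in> borel_measurable M"
  by (induction k) (simp_all add: Let_def)

text \<open>The gap is a supremum of affine functions, and it is a genuine supremum because \<open>F\<close> is
  bounded on the ball. Hence its sublevel sets are closed.\<close>

lemma closed_gap_sublevel: "closed {x. gap F xstar R x \<le> c}"
proof -
  have "bdd_above ((\<lambda>y. F y \<bullet> (x - y)) ` cball xstar R)" for x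
  proof (rule bdd_aboveI2)
    fix y assume y: "y \<in> cball xstar R"
    then have "norm (y - xstar) \<le> R" by (simp add: dist_norm norm_minus_commute)
    moreover have "norm (x - y) \<le> norm (x - xstar) + norm (y - xstar)"
      using norm_triangle_ineq4[of "x - xstar" "y - xstar"] by simp
    ultimately have "norm (F y) * norm (x - y) \<le> (l * R) * (norm (x - xstar) + R)"
      using norm_F_le[of y] y R l
      by (intro mult_mono order_trans[OF norm_F_le] mult_left_mono) auto
    then show "F y \<bullet> (x - y) \<le> (l * R) * (norm (x - xstar) + R)"
      using norm_cauchy_schwarz[of "F y" "x - y"] by linarith
  qed
  then have "{x. gap F xstar R x \<le> c} = (\<Inter>y\<in>cball xstar R. {x. F y \<bullet> (x - y) \<le> c})"
    using R by (auto simp: gap_def cSUP_le_iff)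
  also have "closed \<dots>"
    by (intro closed_INT ballI closed_Collect_le continuous_intros)
  finally show ?thesis .
qed

text \<open>The event on \<open>Z\<close> implies the gap bound. Monotonicity of
  \<open>measure\<close> needs the larger event to be measurable, since a nonmeasurable set gets the
  default value 0.\<close>

lemma gap_prob_le:
  assumes K: "n = Suc K" and c: "9 * R\<^sup>2 / (2 * \<gamma> * real n) \<le> c"
  shows "measure M {\<omega> \<in> space M. gap F xstar R
    (average_iterate (clipped_SGDA G \<gamma> (\<lambda>_. lam) (\<lambda>_. m) x0 (samples \<omega>)) K) \<le> c} \<ge> 1 - exp (- A)"
proof -
  interpret M: prob_space M by (rule M)
  let ?avg = "\<lambda>\<omega>. average_iterate (clipped_SGDA G \<gamma> (\<lambda>_. lam) (\<lambda>_. m) x0 (samples \<omega>)) K"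
  have "?avg \<in> borel_measurable M"
    unfolding average_iterate_def using clipped_SGDA_measurable by measurable
  moreover have "{x. gap F xstar R x \<le> c} \<in> sets borel"
    using closed_gap_sublevel by (rule borel_closed)
  ultimately have "?avg -` {x. gap F xstar R x \<le> c} \<inter> space M \<in> sets M"
    by (rule measurable_sets)
  then have "{\<omega> \<in> space M. gap F xstar R (?avg \<omega>) \<le> c} \<in> sets M"
    by (simp add: vimage_def Int_def conj_commute)
  then have "measure M {\<omega> \<in> space M. Zpath (samples \<omega>) n \<le> R\<^sup>2}
      \<le> measure M {\<omega> \<in> space M. gap F xstar R (?avg \<omega>) \<le> c}"
    by (intro M.finite_measure_mono) (auto intro: order_trans[OF gap_average_le[OF _ K] c])
  then show ?thesis using prob_Zpath_le by simp
qed

end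

lemma gap_prob_ge:
  assumes l: "0 < l" and R: "0 < R" and \<beta>: "0 < \<beta>" "\<beta> \<le> 1" and A: "1 \<le> log_factor \<beta> K"
    and \<gamma>: "0 < \<gamma>" and step: "stepsize_cond l \<beta> K \<gamma>"
    and m: "1 \<le> m" and batch: "batchsize_cond R \<sigma> \<beta> K \<gamma> (real m)"
    and c: "9 * R\<^sup>2 / (2 * \<gamma> * (real K + 1)) \<le> c"
    and problem: "SGDA_problem l R \<sigma> M D G \<xi> x0 xstar proj"
  shows "gap_prob M D G \<xi> x0 xstar R \<beta> \<gamma> m K c \<ge> 1 - \<beta>"
proof -
  define A where "A = log_factor \<beta> K"
  define F where "F = mean_operator D G"
  \<comment> \<open>With this choice the errors of the \<open>Suc K\<close> steps add up to exactly
    \<open>R\<^sup>2\<close>.\<close>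
  define \<delta> where "\<delta> = R\<^sup>2 / (real (Suc K) * (1 + 2 * \<gamma>))"
  have \<delta>: "0 < \<delta>" using R \<gamma> by (simp add: \<delta>_def)
  have so: "sampled_oracle M D G \<xi>" and xs: "is_projection (solution_set F) x0 xstar"
    and sc: "star_cocoercive_on (cball xstar (2 * R)) F proj l"
    using problem by (simp_all add: SGDA_problem_def F_def Let_def)
  have F: "F \<in> borel_measurable borel"
    using so unfolding F_def by (intro mean_operator_measurable) (auto simp: sampled_oracle_def)
  have S: "solution_set F \<noteq> {}" using xs by (auto simp: is_projection_def)
  have h: "(\<lambda>x. (norm (F x))\<^sup>2 / l) \<in> borel_measurable borel" using F by measurable
  obtain p where p: "p \<in> borel_measurable borel" "\<And>x. p x \<in> solution_set F"
    "\<And>x q. q \<in> solution_set F \<Longrightarrow> norm (x - q) = infdist x (solution_set F) \<Longrightarrow>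
      (norm (F x))\<^sup>2 / l \<le> F x \<bullet> (x - q) \<Longrightarrow>
      (norm (x - p x))\<^sup>2 \<le> (infdist x (solution_set F))\<^sup>2 + \<delta> \<and> (norm (F x))\<^sup>2 / l - \<delta> \<le> F x \<bullet> (x - p x)"
    by (rule measurable_approx_projection[OF S F h \<delta>]) blast
  have p': "(norm (x - p x))\<^sup>2 \<le> (infdist x (solution_set F))\<^sup>2 + \<delta> \<and> (norm (F x))\<^sup>2 / l - \<delta> \<le> F x \<bullet> (x - p x)"
    if "x \<in> cball xstar (2 * R)" for x
  proof (rule p(3))
    from sc that have q: "is_projection (solution_set F) x (proj x)"
      and co: "(norm (F x))\<^sup>2 \<le> l * (F x \<bullet> (x - proj x))"
      by (auto simp: star_cocoercive_on_def)
    show "proj x \<in> solution_set F" using q by (simp add: is_projection_def)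
    show "norm (x - proj x) = infdist x (solution_set F)" using q by (rule is_projection_imp_infdist)
    show "(norm (F x))\<^sup>2 / l \<le> F x \<bullet> (x - proj x)" using co l by (simp add: field_simps)
  qed
  interpret clipped_SGDA_run M D G \<xi> x0 xstar proj l R \<sigma> A \<gamma> "clip_level R \<gamma> \<beta> K" "Suc K" m p \<delta>
  proof
    show "170 * l * \<gamma> * A \<le> 1"
      using step l A by (simp add: stepsize_cond_def A_def field_simps)
    show "97200 * real (Suc K) * \<gamma>\<^sup>2 * \<sigma>\<^sup>2 * A \<le> real m * R\<^sup>2"
      using batch R by (simp add: batchsize_cond_def A_def field_simps)
    show "real (Suc K) * (\<delta> * (1 + 2 * \<gamma>)) \<le> R\<^sup>2"
      using \<gamma> by (simp add: \<delta>_def)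
  qed (use problem l R \<gamma> m A \<delta> p p' in \<open>auto simp: A_def F_def clip_level_def\<close>)
  have "exp (- A) = \<beta> / (6 * (real K + 1))"
    using \<beta> by (simp add: A_def log_factor_def exp_minus)
  also have "\<dots> \<le> \<beta> / 1" using \<beta> by (intro divide_left_mono) auto
  finally have "1 - \<beta> \<le> 1 - exp (- A)" by simp
  also have "\<dots> \<le> gap_prob M D G \<xi> x0 xstar R \<beta> \<gamma> m K c"
    unfolding gap_prob_def by (rule gap_prob_le) (use c in \<open>simp_all add: add.commute\<close>)
  finally show ?thesis .
qed

subsection \<open>Parameter choices\<close>

lemma log_factor_ge_1:
  assumes "0 < \<beta>" "\<beta> \<le> 1"
  shows "1 \<le> log_factor \<beta> K"
proof -
  have "exp 1 \<le> (6 :: real)" using exp_le by simp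
  also have "\<dots> \<le> 6 * (real K + 1) / \<beta>"
    using assms by (simp add: field_simps)
  finally show ?thesis
    unfolding log_factor_def using assms by (subst ln_ge_iff) auto
qed

text \<open>The condition on \<open>K\<close> is implicit, since \<open>log_factor\<close> itself
  contains \<open>K\<close>. When \<open>K + 1\<close> is at most a constant times
  \<open>\<rho> * L\<close>, with \<open>L = ln (\<rho> / \<beta>)\<close>, the logarithm splits
  into \<open>k * ln 2\<close>, \<open>L\<close> and \<open>ln L\<close>, each controlled by
  \<open>L\<close>.\<close>

lemma log_factor_le:
  fixes C \<rho> :: real
  assumes \<beta>: "0 < \<beta>" and C: "0 \<le> C" "6 * (C + 1) \<le> 2 ^ k" and \<rho>: "0 < \<rho>"
    and L: "1 \<le> ln (\<rho> / \<beta>)" and K: "real K + 1 \<le> (C + 1) * (\<rho> * ln (\<rho> / \<beta>))"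
  shows "log_factor \<beta> K \<le> (real k + 2) * ln (\<rho> / \<beta>)"
proof -
  define L where "L = ln (\<rho> / \<beta>)"
  have L0: "0 \<le> L" using L unfolding L_def by linarith
  have "6 * (real K + 1) / \<beta> \<le> 6 * ((C + 1) * (\<rho> * L)) / \<beta>"
    using K \<beta> by (intro divide_right_mono mult_left_mono) (auto simp: L_def)
  also have "\<dots> = (6 * (C + 1)) * ((\<rho> / \<beta>) * L)" by simp
  also have "\<dots> \<le> 2 ^ k * ((\<rho> / \<beta>) * L)"
    using C L0 \<rho> \<beta> by (intro mult_right_mono mult_nonneg_nonneg divide_nonneg_nonneg) auto
  finally have "log_factor \<beta> K \<le> ln (2 ^ k * ((\<rho> / \<beta>) * L))"
    unfolding log_factor_def using \<beta> by (intro ln_mono) auto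
  also have "\<dots> = real k * ln 2 + (L + ln L)"
  proof -
    have "ln (2 ^ k * (x * y)) = real k * ln 2 + (ln x + ln y)" if "0 < x" "0 < y" for x y :: real
      using that by (simp add: ln_mult ln_realpow)
    from this[of "\<rho> / \<beta>" L] show ?thesis using \<rho> \<beta> L unfolding L_def[symmetric] by simp
  qed
  also have "\<dots> \<le> real k * L + (L + L)"
  proof (intro add_mono mult_left_mono order_refl)
    show "ln 2 \<le> L" using ln_le_minus_one[of 2] L by (simp add: L_def)
    show "ln L \<le> L" using ln_le_minus_one[of L] L by (simp add: L_def)
  qed simp
  finally show ?thesis by (simp add: L_def algebra_simps)
qed

lemma ex_iterations:
  assumes "1 \<le> (y :: real)"
  obtains K :: nat where "y \<le> real K + 1" "real K + 1 \<le> y + 1"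
proof
  define N where "N = nat \<lceil>y\<rceil>"
  have N: "real N = of_int \<lceil>y\<rceil>" using assms by (simp add: N_def)
  have "1 \<le> \<lceil>y\<rceil>" using assms by linarith
  then have "1 \<le> N" unfolding N_def by linarith
  then have "real (N - 1) + 1 = of_int \<lceil>y\<rceil>" using N by linarith
  then show "y \<le> real (N - 1) + 1" "real (N - 1) + 1 \<le> y + 1" by linarith+
qed

lemma batchsize_cond_ceiling:
  assumes "batchsize_cond R \<sigma> \<beta> K \<gamma> y"
  shows "batchsize_cond R \<sigma> \<beta> K \<gamma> (real (nat \<lceil>y\<rceil>))" and "1 \<le> nat \<lceil>y\<rceil>"
proof -
  have y: "1 \<le> y" using assms by (simp add: batchsize_cond_def)
  then show "1 \<le> nat \<lceil>y\<rceil>" by linarith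
  have "y \<le> real (nat \<lceil>y\<rceil>)" by (rule real_nat_ceiling_ge)
  then show "batchsize_cond R \<sigma> \<beta> K \<gamma> (real (nat \<lceil>y\<rceil>))"
    using assms unfolding batchsize_cond_def by (rule order_trans[rotated])
qed

context
  fixes l R \<sigma> \<beta> :: real and K :: nat
  assumes l: "0 < l" and R: "0 < R" and \<sigma>: "0 \<le> \<sigma>" and A: "1 \<le> log_factor \<beta> K"
begin

lemma stepsize_large_pos: "0 < stepsize_large l \<beta> K"
  using l A by (simp add: stepsize_large_def)

lemma stepsize_large_cond: "stepsize_cond l \<beta> K (stepsize_large l \<beta> K)"
  by (simp add: stepsize_cond_def stepsize_large_def)

text \<open>Substituting the stepsize gives \<open>97200 / 170\<^sup>2 = 972 / 289\<close> and
  cancels one power of the logarithm.\<close>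

lemma batchsize_large_cond:
  "batchsize_cond R \<sigma> \<beta> K (stepsize_large l \<beta> K) (batchsize_large l R \<sigma> \<beta> K)"
proof -
  have "97200 * (real K + 1) * (stepsize_large l \<beta> K)\<^sup>2 * \<sigma>\<^sup>2 * log_factor \<beta> K / R\<^sup>2
      = 972 * (real K + 1) * \<sigma>\<^sup>2 / (289 * l\<^sup>2 * R\<^sup>2 * log_factor \<beta> K)"
    using l A R by (simp add: stepsize_large_def field_simps power2_eq_square)
  then show ?thesis by (simp add: batchsize_cond_def batchsize_large_def)
qed

lemma gap_bound_large:
  "9 * R\<^sup>2 / (2 * stepsize_large l \<beta> K * (real K + 1)) = 765 * l * R\<^sup>2 * log_factor \<beta> K / (real K + 1)"
  using l A by (simp add: stepsize_large_def field_simps)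

lemma stepsize_small_pos: "0 < stepsize_small l R \<sigma> \<beta> K"
  using l A R \<sigma> by (auto simp: stepsize_small_def)

lemma stepsize_small_cond: "stepsize_cond l \<beta> K (stepsize_small l R \<sigma> \<beta> K)"
  by (simp add: stepsize_cond_def stepsize_small_def)

text \<open>The second entry of the minimum is exactly what batch size 1 allows, since
  \<open>97200 = 3 * 180\<^sup>2\<close>.\<close>

lemma batchsize_small_cond: "batchsize_cond R \<sigma> \<beta> K (stepsize_small l R \<sigma> \<beta> K) 1"
proof (cases "\<sigma> = 0")
  case False
  define A where "A = log_factor \<beta> K"
  define g where "g = stepsize_small l R \<sigma> \<beta> K"
  have s: "0 < \<sigma>" using False \<sigma> by simp
  have A0: "0 < A" using A by (simp add: A_def)
  have "g \<le> R / (180 * \<sigma> * sqrt (3 * (real K + 1) * A))"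
    using False by (simp add: g_def stepsize_small_def A_def)
  then have "g\<^sup>2 \<le> (R / (180 * \<sigma> * sqrt (3 * (real K + 1) * A)))\<^sup>2"
    using stepsize_small_pos by (intro power_mono) (simp_all add: g_def)
  also have "\<dots> = R\<^sup>2 / (97200 * \<sigma>\<^sup>2 * ((real K + 1) * A))"
    using A0 by (simp add: power_divide power_mult_distrib)
  finally have "g\<^sup>2 * (97200 * \<sigma>\<^sup>2 * ((real K + 1) * A)) \<le> R\<^sup>2"
    using s A0 by (simp add: pos_le_divide_eq)
  moreover have "97200 * (real K + 1) * g\<^sup>2 * \<sigma>\<^sup>2 * A = g\<^sup>2 * (97200 * \<sigma>\<^sup>2 * ((real K + 1) * A))"
    by (simp only: ac_simps)
  ultimately have "97200 * (real K + 1) * g\<^sup>2 * \<sigma>\<^sup>2 * A \<le> R\<^sup>2" by (simp only:)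
  then have "97200 * (real K + 1) * g\<^sup>2 * \<sigma>\<^sup>2 * A / R\<^sup>2 \<le> 1"
    using R by (simp only: divide_le_eq_1_pos zero_less_power)
  then show ?thesis by (simp add: batchsize_cond_def g_def A_def)
qed (simp add: batchsize_cond_def)

text \<open>Whichever entry attains the minimum in the stepsize produces the corresponding entry of
  the maximum.\<close>

lemma gap_bound_small:
  "9 * R\<^sup>2 / (2 * stepsize_small l R \<sigma> \<beta> K * (real K + 1))
    \<le> max (765 * l * R\<^sup>2 * log_factor \<beta> K / (real K + 1))
          (810 * \<sigma> * R * sqrt (3 * log_factor \<beta> K) / sqrt (real K + 1))"
proof (cases "stepsize_small l R \<sigma> \<beta> K = stepsize_large l \<beta> K")
  case True
  then show ?thesis by (simp add: gap_bound_large)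
next
  case False
  define A where "A = log_factor \<beta> K"
  define s where "s = sqrt (real K + 1)"
  have A0: "0 < A" using A by (simp add: A_def)
  have s: "0 < s" "real K + 1 = s * s" by (simp_all add: s_def)
  have "\<sigma> \<noteq> 0" using False by (auto simp: stepsize_small_def stepsize_large_def)
  then have \<sigma>': "0 < \<sigma>" using \<sigma> by simp
  have "stepsize_small l R \<sigma> \<beta> K = R / (180 * \<sigma> * sqrt (3 * (real K + 1) * A))"
    using False by (auto simp: stepsize_small_def stepsize_large_def A_def min_def split: if_splits)
  also have "sqrt (3 * (real K + 1) * A) = sqrt (3 * A) * s"
    unfolding s_def real_sqrt_mult[symmetric] by (simp only: ac_simps)
  finally have g: "stepsize_small l R \<sigma> \<beta> K = R / (180 * \<sigma> * (sqrt (3 * A) * s))" .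
  have "9 * R\<^sup>2 / (2 * stepsize_small l R \<sigma> \<beta> K * (real K + 1)) = 810 * \<sigma> * R * sqrt (3 * A) / s"
    unfolding g s(2) using R \<sigma>' s(1) A0 by (simp add: field_simps power2_eq_square)
  then show ?thesis by (simp add: A_def s_def)
qed

end

section \<open>Iteration and oracle counts\<close>

lemma large_stepsize_iterations:
  fixes l R \<sigma> \<beta> \<epsilon> :: real
  assumes l: "0 < l" and R: "0 < R" and \<beta>: "0 < \<beta>" "\<beta> \<le> 1" and \<epsilon>: "0 < \<epsilon>"
    and r1: "1 \<le> l * R\<^sup>2 / \<epsilon>" and L1: "1 \<le> ln (l * R\<^sup>2 / (\<epsilon> * \<beta>))"
  obtains K where
    "765 * l * R\<^sup>2 * log_factor \<beta> K / (real K + 1) \<le> \<epsilon>"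
    "real (K + 1) \<le> O_const * (l * R\<^sup>2 / \<epsilon> * ln (l * R\<^sup>2 / (\<epsilon> * \<beta>)))"
    "real (nat \<lceil>batchsize_large l R \<sigma> \<beta> K\<rceil> * (K + 1)) \<le>
      O_const * (max (l * R\<^sup>2 / \<epsilon>) (\<sigma>\<^sup>2 * R\<^sup>2 / \<epsilon>\<^sup>2) * ln (l * R\<^sup>2 / (\<epsilon> * \<beta>)))"
proof -
  define r where "r = l * R\<^sup>2 / \<epsilon>"
  define q where "q = \<sigma>\<^sup>2 * R\<^sup>2 / \<epsilon>\<^sup>2"
  define L where "L = ln (r / \<beta>)"
  have r\<beta>: "l * R\<^sup>2 / (\<epsilon> * \<beta>) = r / \<beta>" by (simp add: r_def)
  have r: "1 \<le> r" and L: "1 \<le> L" using r1 L1 unfolding r\<beta> r_def[symmetric] L_def[symmetric] by simp_all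
  have rL: "1 \<le> r * L" using mult_mono[of 1 r 1 L] r L by simp
  have q: "0 \<le> q" by (simp add: q_def)
  \<comment> \<open>The logarithm will be at most \<open>19 * L\<close>, as
    \<open>6 * 20001 \<le> 2 ^ 17\<close>, and \<open>765 * 19 \<le> 20000\<close>.\<close>
  obtain K where K: "20000 * (r * L) \<le> real K + 1" "real K + 1 \<le> 20000 * (r * L) + 1"
    using ex_iterations[of "20000 * (r * L)"] rL by auto
  define N where "N = real K + 1"
  define A where "A = log_factor \<beta> K"
  have N: "20000 * (r * L) \<le> N" "N \<le> 20001 * (r * L)" using K rL by (simp_all add: N_def)
  have N1: "1 \<le> N" by (simp add: N_def)
  have A1: "1 \<le> A" unfolding A_def using \<beta> by (rule log_factor_ge_1)
  have A_le: "A \<le> 19 * L"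
    using log_factor_le[of \<beta> 20000 17 r K] \<beta> r L N by (simp add: A_def L_def N_def)
  \<comment> \<open>The batch size has \<open>A\<close> in its denominator, so a lower bound on the
    logarithm is needed as well.\<close>
  have A_ge: "L \<le> A"
  proof -
    have "r * 1 \<le> r * L" using r L by (intro mult_left_mono) auto
    then have "r \<le> 6 * N" using N rL by linarith
    then have "r / \<beta> \<le> 6 * N / \<beta>" using \<beta> by (intro divide_right_mono) auto
    then show ?thesis
      unfolding L_def A_def log_factor_def N_def using \<beta> r by (intro ln_mono) auto
  qed
  have "765 * l * R\<^sup>2 * A / N = \<epsilon> * (765 * r * A / N)" using \<epsilon> by (simp add: r_def)
  also have "\<dots> \<le> \<epsilon> * 1"
  proof (intro mult_left_mono)
    have "r * A \<le> r * (19 * L)" using A_le r by (intro mult_left_mono) auto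
    then have "765 * r * A \<le> N" using N rL by linarith
    then show "765 * r * A / N \<le> 1" using N1 by simp
  qed (use \<epsilon> in simp)
  finally have 1: "765 * l * R\<^sup>2 * log_factor \<beta> K / (real K + 1) \<le> \<epsilon>" by (simp add: A_def N_def)
  have 2: "real (K + 1) \<le> O_const * (r * L)"
    using N rL by (simp add: O_const_def N_def)
  define mr where "mr = batchsize_large l R \<sigma> \<beta> K"
  have mr1: "1 \<le> mr" by (simp add: mr_def batchsize_large_def)
  have "real (nat \<lceil>mr\<rceil>) \<le> mr + 1" using mr1 by linarith
  also have "mr \<le> 1 + 972 * N * \<sigma>\<^sup>2 / (289 * l\<^sup>2 * R\<^sup>2 * A)"
    using A1 N1 by (simp add: mr_def batchsize_large_def A_def N_def)
  also have "972 * N * \<sigma>\<^sup>2 / (289 * l\<^sup>2 * R\<^sup>2 * A) = 972 / 289 * (q * N / (r\<^sup>2 * A))"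
    using \<epsilon> R l A1 by (simp add: q_def r_def field_simps power2_eq_square)
  finally have "real (nat \<lceil>mr\<rceil>) * N \<le> (2 + 972 / 289 * (q * N / (r\<^sup>2 * A))) * N"
    using N1 by (intro mult_right_mono) auto
  also have "\<dots> = 2 * N + 972 / 289 * (q * (N\<^sup>2 / (r\<^sup>2 * A)))"
    by (simp add: algebra_simps power2_eq_square)
  \<comment> \<open>As \<open>N\<close> is of order \<open>r * L\<close> and
    \<open>L \<le> A\<close>, the quotient \<open>N\<^sup>2 / (r\<^sup>2 * A)\<close> is of order
    \<open>L\<close>.\<close>
  also have "\<dots> \<le> 2 * (20001 * (r * L)) + 972 / 289 * (q * (20001\<^sup>2 * L))"
  proof (intro add_mono mult_left_mono N(2) q)
    have "N\<^sup>2 \<le> (20001 * (r * L))\<^sup>2" using N N1 by (intro power_mono) auto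
    also have "\<dots> = 20001\<^sup>2 * L * (r\<^sup>2 * L)" by (simp add: power_mult_distrib power2_eq_square)
    also have "\<dots> \<le> 20001\<^sup>2 * L * (r\<^sup>2 * A)" using A_ge L by (intro mult_left_mono) auto
    finally show "N\<^sup>2 / (r\<^sup>2 * A) \<le> 20001\<^sup>2 * L" using r A1 by (simp add: pos_divide_le_eq)
  qed auto
  also have "\<dots> \<le> 2 * (20001 * (max r q * L)) + 972 / 289 * (20001\<^sup>2 * (max r q * L))"
    using L by (intro add_mono mult_left_mono mult_right_mono) auto
  also have "\<dots> \<le> O_const * (max r q * L)"
  proof -
    have "0 \<le> max r q * L" using L r by (intro mult_nonneg_nonneg) auto
    then show ?thesis by (simp add: O_const_def mult.commute)
  qed
  finally have 3: "real (nat \<lceil>mr\<rceil> * (K + 1)) \<le> O_const * (max r q * L)"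
    by (simp add: N_def algebra_simps)
  show thesis
    by (rule that[of K]) (use 1 2 3 in \<open>simp_all only: r\<beta> r_def[symmetric] q_def[symmetric] L_def[symmetric] mr_def[symmetric]\<close>)
qed

lemma small_stepsize_iterations:
  fixes l R \<sigma> \<beta> \<epsilon> :: real
  assumes l: "0 < l" and R: "0 < R" and \<sigma>: "0 \<le> \<sigma>" and \<beta>: "0 < \<beta>" "\<beta> \<le> 1" and \<epsilon>: "0 < \<epsilon>"
    and r1: "1 \<le> max (l * R\<^sup>2 / \<epsilon>) (\<sigma>\<^sup>2 * R\<^sup>2 / \<epsilon>\<^sup>2)"
    and L1: "1 \<le> max (ln (l * R\<^sup>2 / (\<epsilon> * \<beta>))) (ln (\<sigma>\<^sup>2 * R\<^sup>2 / (\<epsilon>\<^sup>2 * \<beta>)))"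
  obtains K where
    "max (765 * l * R\<^sup>2 * log_factor \<beta> K / (real K + 1))
      (810 * \<sigma> * R * sqrt (3 * log_factor \<beta> K) / sqrt (real K + 1)) \<le> \<epsilon>"
    "real (K + 1) \<le> O_const * max (l * R\<^sup>2 / \<epsilon> * ln (l * R\<^sup>2 / (\<epsilon> * \<beta>)))
      (\<sigma>\<^sup>2 * R\<^sup>2 / \<epsilon>\<^sup>2 * ln (\<sigma>\<^sup>2 * R\<^sup>2 / (\<epsilon>\<^sup>2 * \<beta>)))"
proof -
  define r where "r = l * R\<^sup>2 / \<epsilon>"
  define q where "q = \<sigma>\<^sup>2 * R\<^sup>2 / \<epsilon>\<^sup>2"
  define \<rho> where "\<rho> = max r q"
  define L where "L = ln (\<rho> / \<beta>)"
  have r\<beta>: "l * R\<^sup>2 / (\<epsilon> * \<beta>) = r / \<beta>" and q\<beta>: "\<sigma>\<^sup>2 * R\<^sup>2 / (\<epsilon>\<^sup>2 * \<beta>) = q / \<beta>"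
    by (simp_all add: r_def q_def)
  have r: "0 < r" and q: "0 \<le> q" using l R \<epsilon> by (simp_all add: r_def q_def)
  have \<rho>: "1 \<le> \<rho>" using r1 by (simp add: \<rho>_def r_def q_def)
  have L: "1 \<le> L"
  proof -
    have "ln (r / \<beta>) \<le> L"
      unfolding L_def using r \<beta> by (intro ln_mono divide_right_mono) (auto simp: \<rho>_def)
    \<comment> \<open>For \<open>\<sigma> = 0\<close> the ratio \<open>q\<close> vanishes and
      \<open>ln 0\<close> evaluates to 0, so monotonicity of \<open>ln\<close> is replaced by
      \<open>0 \<le> L\<close>.\<close>
    moreover have "ln (q / \<beta>) \<le> L"
    proof (cases "q = 0")
      case True
      have "0 \<le> L" using \<rho> \<beta> by (simp add: L_def)
      then show ?thesis using True by simp
    next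
      case False
      then show ?thesis
        unfolding L_def using q \<beta> by (intro ln_mono divide_right_mono) (auto simp: \<rho>_def)
    qed
    ultimately show ?thesis using L1 by (auto simp: r\<beta> q\<beta>)
  qed
  have \<rho>L: "1 \<le> \<rho> * L" using mult_mono[of 1 \<rho> 1 L] \<rho> L by simp
  \<comment> \<open>Here the logarithm is at most \<open>32 * L\<close>, as
    \<open>6 * (10 ^ 8 + 1) \<le> 2 ^ 30\<close>. Squaring the second bound gives
    \<open>3 * 810\<^sup>2 = 1968300\<close>, and \<open>32 * 1968300 \<le> 10 ^ 8\<close>.\<close>
  obtain K where K: "10 ^ 8 * (\<rho> * L) \<le> real K + 1" "real K + 1 \<le> 10 ^ 8 * (\<rho> * L) + 1"
    using ex_iterations[of "10 ^ 8 * (\<rho> * L)"] \<rho>L by auto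
  define N where "N = real K + 1"
  define A where "A = log_factor \<beta> K"
  have N: "10 ^ 8 * (\<rho> * L) \<le> N" "N \<le> (10 ^ 8 + 1) * (\<rho> * L)" using K \<rho>L by (simp_all add: N_def)
  have N1: "1 \<le> N" by (simp add: N_def)
  have A1: "1 \<le> A" unfolding A_def using \<beta> by (rule log_factor_ge_1)
  have A_le: "A \<le> 32 * L"
    using log_factor_le[of \<beta> "10 ^ 8" 30 \<rho> K] \<beta> \<rho> L N by (simp add: A_def L_def N_def)
  have \<rho>A: "\<rho> * A \<le> \<rho> * (32 * L)" using A_le \<rho> by (intro mult_left_mono) auto
  have "765 * l * R\<^sup>2 * A / N = \<epsilon> * (765 * (r * A) / N)" using \<epsilon> by (simp add: r_def)
  also have "\<dots> \<le> \<epsilon> * 1"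
  proof (intro mult_left_mono)
    have "r * A \<le> \<rho> * A" using A1 by (intro mult_right_mono) (auto simp: \<rho>_def)
    then have "765 * (r * A) \<le> N" using N \<rho>A \<rho>L by simp
    then show "765 * (r * A) / N \<le> 1" using N1 by simp
  qed (use \<epsilon> in simp)
  finally have 1: "765 * l * R\<^sup>2 * A / N \<le> \<epsilon>" by simp
  have 2: "810 * \<sigma> * R * sqrt (3 * A) / sqrt N \<le> \<epsilon>"
  proof (rule power2_le_imp_le)
    have "(810 * \<sigma> * R * sqrt (3 * A) / sqrt N)\<^sup>2 = \<epsilon>\<^sup>2 * (1968300 * (q * A) / N)"
      using A1 N1 \<epsilon> by (simp add: power_mult_distrib power_divide q_def)
    also have "\<dots> \<le> \<epsilon>\<^sup>2 * 1"
    proof (intro mult_left_mono)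
      have "q * A \<le> \<rho> * A" using A1 by (intro mult_right_mono) (auto simp: \<rho>_def)
      then have "1968300 * (q * A) \<le> N" using N \<rho>A \<rho>L by simp
      then show "1968300 * (q * A) / N \<le> 1" using N1 by simp
    qed simp
    finally show "(810 * \<sigma> * R * sqrt (3 * A) / sqrt N)\<^sup>2 \<le> \<epsilon>\<^sup>2" by simp
  qed (use \<epsilon> in simp)
  \<comment> \<open>The product formed from the larger of the two ratios equals
    \<open>\<rho> * L\<close>.\<close>
  have "\<rho> * L \<le> max (r * ln (r / \<beta>)) (q * ln (q / \<beta>))"
    unfolding L_def \<rho>_def by (auto simp: max_def)
  then have "O_const * (\<rho> * L) \<le> O_const * max (r * ln (r / \<beta>)) (q * ln (q / \<beta>))"
    by (intro mult_left_mono) (simp_all add: O_const_def)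
  moreover have "real (K + 1) \<le> O_const * (\<rho> * L)"
    using N \<rho>L by (simp add: O_const_def N_def)
  ultimately have 3: "real (K + 1) \<le> O_const * max (r * ln (r / \<beta>)) (q * ln (q / \<beta>))"
    by (rule order_trans[rotated])
  show thesis
    by (rule that[of K])
      (use 1 2 3 in \<open>simp_all only: r\<beta> q\<beta> r_def[symmetric] q_def[symmetric] N_def A_def max.bounded_iff\<close>)
qed

text \<open>In the complexity claims \<open>K\<close> is chosen before the measures, the oracle and
  the starting point, so the same count serves every problem instance with the given
  parameters.\<close>

theorem corollaryD1:
  fixes l R \<sigma> \<beta> :: real
  assumes "l > 0" and "R > 0" and "\<sigma> \<ge> 0" and "0 < \<beta>" and "\<beta> \<le> 1"
  shows
    "(\<forall>K. log_factor \<beta> K \<ge> 1 \<longrightarrow>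
       (let \<gamma> = stepsize_large l \<beta> K; m = nat \<lceil>batchsize_large l R \<sigma> \<beta> K\<rceil> in
         stepsize_cond l \<beta> K \<gamma> \<and>
         batchsize_cond R \<sigma> \<beta> K \<gamma> (batchsize_large l R \<sigma> \<beta> K) \<and>
         batchsize_cond R \<sigma> \<beta> K \<gamma> (real m) \<and>
         (\<forall>(M :: 'w measure) (D :: 's measure) (G :: 's \<Rightarrow> real ^ 'd \<Rightarrow> real ^ 'd) \<xi> x0 xstar proj.
            SGDA_problem l R \<sigma> M D G \<xi> x0 xstar proj \<longrightarrow>
            gap_prob M D G \<xi> x0 xstar R \<beta> \<gamma> m K
              (765 * l * R\<^sup>2 * log_factor \<beta> K / (real K + 1)) \<ge> 1 - \<beta>)))
   \<and> (\<forall>\<epsilon>>0. l * R\<^sup>2 / \<epsilon> \<ge> 1 \<and> ln (l * R\<^sup>2 / (\<epsilon> * \<beta>)) \<ge> 1 \<longrightarrow>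
       (\<exists>K. log_factor \<beta> K \<ge> 1 \<and>
         (let \<gamma> = stepsize_large l \<beta> K; m = nat \<lceil>batchsize_large l R \<sigma> \<beta> K\<rceil> in
           real (K + 1) \<le> O_const * (l * R\<^sup>2 / \<epsilon> * ln (l * R\<^sup>2 / (\<epsilon> * \<beta>))) \<and>
           real (m * (K + 1)) \<le>
             O_const * (max (l * R\<^sup>2 / \<epsilon>) (\<sigma>\<^sup>2 * R\<^sup>2 / \<epsilon>\<^sup>2) * ln (l * R\<^sup>2 / (\<epsilon> * \<beta>))) \<and>
           (\<forall>(M :: 'w measure) (D :: 's measure) (G :: 's \<Rightarrow> real ^ 'd \<Rightarrow> real ^ 'd) \<xi> x0 xstar proj.
              SGDA_problem l R \<sigma> M D G \<xi> x0 xstar proj \<longrightarrow>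
              gap_prob M D G \<xi> x0 xstar R \<beta> \<gamma> m K \<epsilon> \<ge> 1 - \<beta>))))
   \<and> (\<forall>K. log_factor \<beta> K \<ge> 1 \<longrightarrow>
       (let \<gamma> = stepsize_small l R \<sigma> \<beta> K in
         stepsize_cond l \<beta> K \<gamma> \<and>
         batchsize_cond R \<sigma> \<beta> K \<gamma> 1 \<and>
         (\<forall>(M :: 'w measure) (D :: 's measure) (G :: 's \<Rightarrow> real ^ 'd \<Rightarrow> real ^ 'd) \<xi> x0 xstar proj.
            SGDA_problem l R \<sigma> M D G \<xi> x0 xstar proj \<longrightarrow>
            gap_prob M D G \<xi> x0 xstar R \<beta> \<gamma> 1 K
              (max (765 * l * R\<^sup>2 * log_factor \<beta> K / (real K + 1))
                   (810 * \<sigma> * R * sqrt (3 * log_factor \<beta> K) / sqrt (real K + 1))) \<ge> 1 - \<beta>)))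
   \<and> (\<forall>\<epsilon>>0. max (l * R\<^sup>2 / \<epsilon>) (\<sigma>\<^sup>2 * R\<^sup>2 / \<epsilon>\<^sup>2) \<ge> 1 \<and>
             max (ln (l * R\<^sup>2 / (\<epsilon> * \<beta>))) (ln (\<sigma>\<^sup>2 * R\<^sup>2 / (\<epsilon>\<^sup>2 * \<beta>))) \<ge> 1 \<longrightarrow>
       (\<exists>K. log_factor \<beta> K \<ge> 1 \<and>
         (let \<gamma> = stepsize_small l R \<sigma> \<beta> K in
           real (K + 1) \<le>
             O_const * max (l * R\<^sup>2 / \<epsilon> * ln (l * R\<^sup>2 / (\<epsilon> * \<beta>)))
                           (\<sigma>\<^sup>2 * R\<^sup>2 / \<epsilon>\<^sup>2 * ln (\<sigma>\<^sup>2 * R\<^sup>2 / (\<epsilon>\<^sup>2 * \<beta>))) \<and>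
           (\<forall>(M :: 'w measure) (D :: 's measure) (G :: 's \<Rightarrow> real ^ 'd \<Rightarrow> real ^ 'd) \<xi> x0 xstar proj.
              SGDA_problem l R \<sigma> M D G \<xi> x0 xstar proj \<longrightarrow>
              gap_prob M D G \<xi> x0 xstar R \<beta> \<gamma> 1 K \<epsilon> \<ge> 1 - \<beta>))))"
  unfolding Let_def
proof (intro conjI allI impI)
  fix K and M :: "'w measure" and D :: "'s measure" and G :: "'s \<Rightarrow> real ^ 'd \<Rightarrow> real ^ 'd"
    and \<xi> x0 xstar proj
  assume A: "1 \<le> log_factor \<beta> K"
  note large = stepsize_large_pos[OF assms(1-3) A] stepsize_large_cond[OF assms(1-3) A]
    batchsize_large_cond[OF assms(1-3) A]
  note small = stepsize_small_pos[OF assms(1-3) A] stepsize_small_cond[OF assms(1-3) A]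
    batchsize_small_cond[OF assms(1-3) A]
  show "stepsize_cond l \<beta> K (stepsize_large l \<beta> K)" by (rule large)
  show "batchsize_cond R \<sigma> \<beta> K (stepsize_large l \<beta> K) (batchsize_large l R \<sigma> \<beta> K)" by (rule large)
  then show "batchsize_cond R \<sigma> \<beta> K (stepsize_large l \<beta> K) (real (nat \<lceil>batchsize_large l R \<sigma> \<beta> K\<rceil>))"
    by (rule batchsize_cond_ceiling)
  show "stepsize_cond l \<beta> K (stepsize_small l R \<sigma> \<beta> K)" by (rule small)
  show "batchsize_cond R \<sigma> \<beta> K (stepsize_small l R \<sigma> \<beta> K) 1" by (rule small)
  assume problem: "SGDA_problem l R \<sigma> M D G \<xi> x0 xstar proj"
  show "1 - \<beta> \<le> gap_prob M D G \<xi> x0 xstar R \<beta> (stepsize_large l \<beta> K) (nat \<lceil>batchsize_large l R \<sigma> \<beta> K\<rceil>) K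
      (765 * l * R\<^sup>2 * log_factor \<beta> K / (real K + 1))"
    by (rule gap_prob_ge[OF assms(1,2,4,5) A large(1,2)
          batchsize_cond_ceiling(2,1)[OF large(3)] _ problem])
      (simp only: gap_bound_large[OF assms(1-3) A])
  show "1 - \<beta> \<le> gap_prob M D G \<xi> x0 xstar R \<beta> (stepsize_small l R \<sigma> \<beta> K) 1 K
      (max (765 * l * R\<^sup>2 * log_factor \<beta> K / (real K + 1))
        (810 * \<sigma> * R * sqrt (3 * log_factor \<beta> K) / sqrt (real K + 1)))"
    by (rule gap_prob_ge[OF assms(1,2,4,5) A small(1,2) _ _ gap_bound_small[OF assms(1-3) A] problem])
      (use small(3) in simp_all)
next
  fix \<epsilon> :: real
  assume \<epsilon>: "0 < \<epsilon>" and "1 \<le> l * R\<^sup>2 / \<epsilon> \<and> 1 \<le> ln (l * R\<^sup>2 / (\<epsilon> * \<beta>))"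
  then obtain K where K: "765 * l * R\<^sup>2 * log_factor \<beta> K / (real K + 1) \<le> \<epsilon>"
    "real (K + 1) \<le> O_const * (l * R\<^sup>2 / \<epsilon> * ln (l * R\<^sup>2 / (\<epsilon> * \<beta>)))"
    "real (nat \<lceil>batchsize_large l R \<sigma> \<beta> K\<rceil> * (K + 1)) \<le>
      O_const * (max (l * R\<^sup>2 / \<epsilon>) (\<sigma>\<^sup>2 * R\<^sup>2 / \<epsilon>\<^sup>2) * ln (l * R\<^sup>2 / (\<epsilon> * \<beta>)))"
    using large_stepsize_iterations[OF assms(1,2,4,5) \<epsilon>] by blast
  have A: "1 \<le> log_factor \<beta> K" using assms(4,5) by (rule log_factor_ge_1)
  note large = stepsize_large_pos[OF assms(1-3) A] stepsize_large_cond[OF assms(1-3) A]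
    batchsize_large_cond[OF assms(1-3) A]
  have "1 - \<beta> \<le> gap_prob M D G \<xi> x0 xstar R \<beta> (stepsize_large l \<beta> K) (nat \<lceil>batchsize_large l R \<sigma> \<beta> K\<rceil>) K \<epsilon>"
    if problem: "SGDA_problem l R \<sigma> M D G \<xi> x0 xstar proj"
    for M :: "'w measure" and D :: "'s measure" and G :: "'s \<Rightarrow> real ^ 'd \<Rightarrow> real ^ 'd" and \<xi> x0 xstar proj
    by (rule gap_prob_ge[OF assms(1,2,4,5) A large(1,2)
          batchsize_cond_ceiling(2,1)[OF large(3)] _ problem])
      (simp only: gap_bound_large[OF assms(1-3) A] K(1))
  with A K show "\<exists>K. 1 \<le> log_factor \<beta> K \<and>
      real (K + 1) \<le> O_const * (l * R\<^sup>2 / \<epsilon> * ln (l * R\<^sup>2 / (\<epsilon> * \<beta>))) \<and>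
      real (nat \<lceil>batchsize_large l R \<sigma> \<beta> K\<rceil> * (K + 1)) \<le>
        O_const * (max (l * R\<^sup>2 / \<epsilon>) (\<sigma>\<^sup>2 * R\<^sup>2 / \<epsilon>\<^sup>2) * ln (l * R\<^sup>2 / (\<epsilon> * \<beta>))) \<and>
      (\<forall>(M :: 'w measure) (D :: 's measure) (G :: 's \<Rightarrow> real ^ 'd \<Rightarrow> real ^ 'd) \<xi> x0 xstar proj.
        SGDA_problem l R \<sigma> M D G \<xi> x0 xstar proj \<longrightarrow>
        1 - \<beta> \<le> gap_prob M D G \<xi> x0 xstar R \<beta> (stepsize_large l \<beta> K) (nat \<lceil>batchsize_large l R \<sigma> \<beta> K\<rceil>) K \<epsilon>)"
    by (intro exI[of _ K] conjI allI impI)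
next
  fix \<epsilon> :: real
  assume \<epsilon>: "0 < \<epsilon>" and "1 \<le> max (l * R\<^sup>2 / \<epsilon>) (\<sigma>\<^sup>2 * R\<^sup>2 / \<epsilon>\<^sup>2) \<and>
    1 \<le> max (ln (l * R\<^sup>2 / (\<epsilon> * \<beta>))) (ln (\<sigma>\<^sup>2 * R\<^sup>2 / (\<epsilon>\<^sup>2 * \<beta>)))"
  then obtain K where K: "max (765 * l * R\<^sup>2 * log_factor \<beta> K / (real K + 1))
      (810 * \<sigma> * R * sqrt (3 * log_factor \<beta> K) / sqrt (real K + 1)) \<le> \<epsilon>"
    "real (K + 1) \<le> O_const * max (l * R\<^sup>2 / \<epsilon> * ln (l * R\<^sup>2 / (\<epsilon> * \<beta>)))
      (\<sigma>\<^sup>2 * R\<^sup>2 / \<epsilon>\<^sup>2 * ln (\<sigma>\<^sup>2 * R\<^sup>2 / (\<epsilon>\<^sup>2 * \<beta>)))"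
    using small_stepsize_iterations[OF assms \<epsilon>] by blast
  have A: "1 \<le> log_factor \<beta> K" using assms(4,5) by (rule log_factor_ge_1)
  note small = stepsize_small_pos[OF assms(1-3) A] stepsize_small_cond[OF assms(1-3) A]
    batchsize_small_cond[OF assms(1-3) A]
  have "1 - \<beta> \<le> gap_prob M D G \<xi> x0 xstar R \<beta> (stepsize_small l R \<sigma> \<beta> K) 1 K \<epsilon>"
    if problem: "SGDA_problem l R \<sigma> M D G \<xi> x0 xstar proj"
    for M :: "'w measure" and D :: "'s measure" and G :: "'s \<Rightarrow> real ^ 'd \<Rightarrow> real ^ 'd" and \<xi> x0 xstar proj
    by (rule gap_prob_ge[OF assms(1,2,4,5) A small(1,2) _ _
          order_trans[OF gap_bound_small[OF assms(1-3) A] K(1)] problem])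
      (use small(3) in simp_all)
  with A K show "\<exists>K. 1 \<le> log_factor \<beta> K \<and>
      real (K + 1) \<le> O_const * max (l * R\<^sup>2 / \<epsilon> * ln (l * R\<^sup>2 / (\<epsilon> * \<beta>)))
        (\<sigma>\<^sup>2 * R\<^sup>2 / \<epsilon>\<^sup>2 * ln (\<sigma>\<^sup>2 * R\<^sup>2 / (\<epsilon>\<^sup>2 * \<beta>))) \<and>
      (\<forall>(M :: 'w measure) (D :: 's measure) (G :: 's \<Rightarrow> real ^ 'd \<Rightarrow> real ^ 'd) \<xi> x0 xstar proj.
        SGDA_problem l R \<sigma> M D G \<xi> x0 xstar proj \<longrightarrow>
        1 - \<beta> \<le> gap_prob M D G \<xi> x0 xstar R \<beta> (stepsize_small l R \<sigma> \<beta> K) 1 K \<epsilon>)"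
    by (intro exI[of _ K] conjI allI impI)
qed

end
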